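(* Let $G\neq T_{n,2}$ be an $n$-vertex graph with $\lambda:=\lambda(G)\ge\lambda(T_{n,2})$. (a) $\operatorname{bk}(G)=2\lambda-n$ if and only if $G=T_{n,r}$ for some $r\ge3$ with $r\mid n$. (b) $\operatorname{bk}(G)=\lambda-\frac n3$ if and only if $G$ is $d$-regular for some $d\ge\frac n2$ and, in addition, either $d=\frac n2$, $G$ has a triangle and every edge of $G$ lies in $0$ or $\frac n6$ triangles; or $d>\frac n2$ and $G$ is $K_4$-free, every edge of $G$ lies in exactly $\operatorname{bk}(G)$ triangles, and $G-N[v]$ is triangle-free for every vertex $v$.
   Context: Graphs are finite and simple. $\lambda(G)$ is the spectral radius of the adjacency matrix of $G$. The booksize is $\operatorname{bk}(G)=\max_{uv\in E(G)}|N(u)\cap N(v)|$, the maximum number of triangles sharing a common edge. $T_{n,r}$ is the $r$-partite Turán graph: the complete $r$-partite graph on $n$ vertices whose part sizes differ by at most one. Equality of graphs means isomorphism. $N[v]=N(v)\cup\{v\}$ is the closed neighborhood of $v$, and $G-N[v]$ is the graph obtained from $G$ by deleting the vertices of $N[v]$. *)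

theory Defs
  imports "Jordan_Normal_Form.Spectral_Radius"
begin

type_synonym 'a ugraph = "'a set \<times> 'a set set"

abbreviation verts :: "'a ugraph \<Rightarrow> 'a set" where "verts \<equiv> fst"
abbreviation edges :: "'a ugraph \<Rightarrow> 'a set set" where "edges \<equiv> snd"

definition simple_graph :: "'a ugraph \<Rightarrow> bool" where
  "simple_graph G \<longleftrightarrow> finite (verts G) \<and> (\<forall>e\<in>edges G. e \<subseteq> verts G \<and> card e = 2)"

definition graph_iso :: "'a ugraph \<Rightarrow> 'b ugraph \<Rightarrow> bool" where
  "graph_iso G H \<longleftrightarrow> (\<exists>f. bij_betw f (verts G) (verts H) \<and>
     (\<forall>u\<in>verts G. \<forall>v\<in>verts G. {u, v} \<in> edges G \<longleftrightarrow> {f u, f v} \<in> edges H))"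

definition neighborhood :: "'a ugraph \<Rightarrow> 'a \<Rightarrow> 'a set" where
  "neighborhood G v = {u \<in> verts G. {u, v} \<in> edges G}"

definition closed_neighborhood :: "'a ugraph \<Rightarrow> 'a \<Rightarrow> 'a set" where
  "closed_neighborhood G v = insert v (neighborhood G v)"

definition vertex_degree :: "'a ugraph \<Rightarrow> 'a \<Rightarrow> nat" where
  "vertex_degree G v = card (neighborhood G v)"

definition regular :: "'a ugraph \<Rightarrow> nat \<Rightarrow> bool" where
  "regular G d \<longleftrightarrow> (\<forall>v\<in>verts G. vertex_degree G v = d)"

definition delete_verts :: "'a ugraph \<Rightarrow> 'a set \<Rightarrow> 'a ugraph" where
  "delete_verts G S = (verts G - S, {e \<in> edges G. e \<inter> S = {}})"

definition clique :: "'a ugraph \<Rightarrow> 'a set \<Rightarrow> bool" where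
  "clique G S \<longleftrightarrow> S \<subseteq> verts G \<and> (\<forall>u\<in>S. \<forall>v\<in>S. u \<noteq> v \<longrightarrow> {u, v} \<in> edges G)"

text \<open>\<open>contains_complete G k\<close>: \<open>G\<close> has a (not necessarily induced) subgraph \<open>K\<^sub>k\<close>;
  for \<open>k = 3\<close> this is a triangle.\<close>

definition contains_complete :: "'a ugraph \<Rightarrow> nat \<Rightarrow> bool" where
  "contains_complete G k \<longleftrightarrow> (\<exists>S. clique G S \<and> finite S \<and> card S = k)"

text \<open>In a simple graph the triangles on the edge \<open>{u, v}\<close> correspond to the common neighbours
  of \<open>u\<close> and \<open>v\<close>.\<close>

definition edge_triangles :: "'a ugraph \<Rightarrow> 'a \<Rightarrow> 'a \<Rightarrow> nat" where
  "edge_triangles G u v = card (neighborhood G u \<inter> neighborhood G v)"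

text \<open>Unspecified (as a maximum over the empty set) if \<open>G\<close> has no edges.\<close>

definition booksize :: "'a ugraph \<Rightarrow> nat" where
  "booksize G = Max {edge_triangles G u v | u v. {u, v} \<in> edges G}"

text \<open>The matrix is indexed by the positions in a list \<open>vs\<close> enumerating the vertices. The choice
  of the enumeration does not affect the spectral radius, see \<open>graph_radius_eq\<close> below. For the
  graph without vertices, the spectral radius is unspecified.\<close>

definition adjacency_matrix :: "'a ugraph \<Rightarrow> 'a list \<Rightarrow> complex mat" where
  "adjacency_matrix G vs = mat (length vs) (length vs)
     (\<lambda>(i, j). if {vs ! i, vs ! j} \<in> edges G then 1 else 0)"

definition graph_radius :: "'a ugraph \<Rightarrow> real" where
  "graph_radius G =
     spectral_radius (adjacency_matrix G (SOME vs. distinct vs \<and> set vs = verts G))"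

text \<open>The residue classes modulo \<open>r\<close> partition \<open>{..<n}\<close> into \<open>r\<close> parts whose sizes differ by at
  most one, see \<open>turan_part_sizes\<close> below (parts are empty if \<open>r > n\<close>).\<close>

definition turan :: "nat \<Rightarrow> nat \<Rightarrow> nat ugraph" where
  "turan n r = ({..<n}, {{i, j} | i j. i < n \<and> j < n \<and> i mod r \<noteq> j mod r})"

lemma simple_graph_turan: "simple_graph (turan n r)"
  by (auto simp: simple_graph_def turan_def card_insert_if)

lemma turan_part_sizes:
  assumes "k < r"
  shows "card {i \<in> verts (turan n r). i mod r = k} \<in> {n div r, Suc (n div r)}"
proof -
  have r: "r > 0" using assms by simp
  have A: "card {i. i < n \<and> i mod r = k} = n div r + (if k < n mod r then 1 else 0)" for n
  proof (induction n)
    case (Suc n)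
    have "{i. i < Suc n \<and> i mod r = k} =
        (if n mod r = k then insert n {i. i < n \<and> i mod r = k} else {i. i < n \<and> i mod r = k})"
      by (auto simp: less_Suc_eq)
    then have "card {i. i < Suc n \<and> i mod r = k} =
        card {i. i < n \<and> i mod r = k} + (if n mod r = k then 1 else 0)"
      by simp
    with Suc show ?case using r assms by (auto simp: mod_Suc div_Suc)
  qed simp
  show ?thesis using A[of n] by (simp add: turan_def)
qed

lemma eigenvalue_adjacency_matrix_permute:
  assumes vs: "distinct vs" and ws: "distinct ws" and eq: "set vs = set ws"
    and ev: "eigenvalue (adjacency_matrix G vs) k"
  shows "eigenvalue (adjacency_matrix G ws) k"
proof -
  define n where "n = length vs"
  have nw: "length ws = n" using vs ws eq n_def by (metis distinct_card)
  have bv: "bij_betw ((!) vs) {..<n} (set vs)" and bw: "bij_betw ((!) ws) {..<n} (set ws)"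
    using vs ws nw by (auto intro!: bij_betw_nth simp: n_def)
  define p where "p = inv_into {..<n} ((!) vs) \<circ> (!) ws"
  have p: "bij_betw p {..<n} {..<n}"
    unfolding p_def by (rule bij_betw_trans[OF bw]) (use bij_betw_inv_into[OF bv] eq in simp)
  have pv: "vs ! p i = ws ! i" if "i < n" for i
  proof -
    have "ws ! i \<in> set vs" using that nw eq by simp
    then show ?thesis using bij_betw_inv_into_right[OF bv] by (simp add: p_def)
  qed
  have pn: "p i < n" if "i < n" for i using p that by (auto simp: bij_betw_def)
  let ?A = "adjacency_matrix G vs" and ?B = "adjacency_matrix G ws"
  obtain x where x: "x \<in> carrier_vec n" "x \<noteq> 0\<^sub>v n" "?A *\<^sub>v x = k \<cdot>\<^sub>v x"
    using ev unfolding eigenvalue_def eigenvector_def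
    by (auto simp: adjacency_matrix_def n_def)
  define y where "y = vec n (\<lambda>i. x $ p i)"
  have "?B *\<^sub>v y = k \<cdot>\<^sub>v y"
  proof (rule eq_vecI)
    fix i assume "i < dim_vec (k \<cdot>\<^sub>v y)"
    then have i: "i < n" by (simp add: y_def)
    have "(?B *\<^sub>v y) $ i =
        (\<Sum>j\<in>{..<n}. (if {vs ! p i, vs ! p j} \<in> edges G then 1 else 0) * x $ p j)"
      using i nw by (auto simp: adjacency_matrix_def scalar_prod_def y_def pv atLeast0LessThan)
    also have "\<dots> = (\<Sum>j\<in>{..<n}. (if {vs ! p i, vs ! j} \<in> edges G then 1 else 0) * x $ j)"
      by (rule sum.reindex_bij_betw[OF p])
    also have "\<dots> = (?A *\<^sub>v x) $ p i"
      using pn[OF i] x(1) by (auto simp: adjacency_matrix_def scalar_prod_def n_def atLeast0LessThan)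
    also have "\<dots> = (k \<cdot>\<^sub>v y) $ i" using x i pn[OF i] by (simp add: y_def)
    finally show "(?B *\<^sub>v y) $ i = (k \<cdot>\<^sub>v y) $ i" .
  qed (simp add: adjacency_matrix_def y_def nw)
  moreover have "y \<noteq> 0\<^sub>v n"
  proof
    assume y0: "y = 0\<^sub>v n"
    have "x $ j = 0" if "j < n" for j
    proof -
      obtain i where "i < n" "p i = j" using p \<open>j < n\<close> unfolding bij_betw_def by (metis imageE lessThan_iff)
      then show ?thesis using y0 by (metis index_vec index_zero_vec(1) y_def)
    qed
    then have "x = 0\<^sub>v n" using x(1) by auto
    with x(2) show False ..
  qed
  ultimately show ?thesis
    unfolding eigenvalue_def eigenvector_def
    by (intro exI[of _ y]) (auto simp: adjacency_matrix_def nw y_def)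
qed

lemma graph_radius_eq:
  assumes "distinct vs" "set vs = verts G"
  shows "graph_radius G = spectral_radius (adjacency_matrix G vs)"
proof -
  let ?ws = "SOME ws. distinct ws \<and> set ws = verts G"
  have "distinct ?ws \<and> set ?ws = verts G" by (rule someI[of _ vs]) (use assms in simp)
  then have "spectrum (adjacency_matrix G ?ws) = spectrum (adjacency_matrix G vs)"
    using assms eigenvalue_adjacency_matrix_permute[of vs ?ws G]
      eigenvalue_adjacency_matrix_permute[of ?ws vs G]
    unfolding spectrum_def by blast
  then show ?thesis by (simp add: graph_radius_def spectral_radius_def)
qed

end

theory Submission
  imports Defs "HOL-Analysis.Function_Topology"
begin

text \<open>
  Let \<open>x\<close> be a nonnegative eigenvector for \<open>\<lambda>\<close>, \<open>S\<close> the sum of its entries, and \<open>C(u, v)\<close> the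
  sum of \<open>x\<close> over the common neighbours of \<open>u\<close> and \<open>v\<close>. Counting how often a vertex is seen from
  an edge or a triangle gives \<open>\<lambda>(x\<^sub>u + x\<^sub>v) - S \<le> C(u, v)\<close> and
  \<open>\<lambda>(x\<^sub>u + x\<^sub>v + x\<^sub>w) - S \<le> C(u, v) + C(v, w) + C(u, w)\<close>.

  For (a), the edge inequality weighted by \<open>x\<^sub>u x\<^sub>v\<close> yields
  \<open>2\<lambda> \<Sum>x\<^sup>3 \<le> S \<Sum>x\<^sup>2 + bk \<Sum>x\<^sup>3\<close>. If \<open>bk = 2\<lambda> - n\<close>, then equality holds in Chebyshev's sum
  inequality, so \<open>x\<close> is constant and \<open>G\<close> is regular; moreover \<open>N(u) \<union> N(v)\<close> is the whole vertex
  set for every edge, so non-adjacency is an equivalence relation with classes of equal size.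

  For (b), the triangle inequality summed over all triangles, combined with the edge inequality
  weighted by the deficiencies \<open>bk - |N(u) \<inter> N(v)|\<close>, yields \<open>3\<lambda>(\<lambda> - bk) \<le> 2m\<close> as soon as
  \<open>3 bk \<ge> \<lambda>\<close>, where \<open>m\<close> is the number of edges. If \<open>bk = \<lambda> - n/3\<close>, this reads
  \<open>\<lambda>n \<le> 2m\<close>, so \<open>G\<close> is regular. For regular graphs the unweighted triangle inequality is an
  identity up to an excess term, which vanishes precisely under the stated conditions.
\<close>

subsection \<open>Rayleigh quotients\<close>

text \<open>The form is maximised over the nonnegative unit vectors supported on \<open>V\<close>, a
  compact set. Replacing \<open>y\<close> by its normalised absolute values does not lower the
  Rayleigh quotient, as \<open>A\<close> is nonnegative, so this maximiser bounds the form on all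
  vectors.\<close>

lemma nonneg_Rayleigh_maximizer:
  fixes A :: "'a \<Rightarrow> 'a \<Rightarrow> real"
  assumes fin: "finite V" and ne: "V \<noteq> {}" and nonneg: "\<And>u v. A u v \<ge> 0"
  obtains x where "\<And>u. x u \<ge> 0" "(\<Sum>u\<in>V. (x u)\<^sup>2) = 1"
    "\<And>y. (\<Sum>u\<in>V. \<Sum>v\<in>V. A u v * y u * y v)
          \<le> (\<Sum>u\<in>V. \<Sum>v\<in>V. A u v * x u * x v) * (\<Sum>u\<in>V. (y u)\<^sup>2)"
proof -
  define Q where "Q y = (\<Sum>u\<in>V. \<Sum>v\<in>V. A u v * y u * y v)" for y :: "'a \<Rightarrow> real"
  define N where "N y = (\<Sum>u\<in>V. (y u)\<^sup>2)" for y :: "'a \<Rightarrow> real"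
  \<comment> \<open>Pinning the coordinates outside \<open>V\<close> to 0 makes \<open>B\<close> a
    product of compact sets, hence compact in the product topology.\<close>
  define B :: "('a \<Rightarrow> real) set" where "B = PiE UNIV (\<lambda>u. if u \<in> V then {0..1} else {0})"
  have contQ: "continuous_on UNIV Q" and contN: "continuous_on UNIV N"
    unfolding Q_def N_def by (intro continuous_intros continuous_on_product_coordinates)+
  have "compact B"
    unfolding B_def compactin_euclidean_iff[symmetric] euclidean_product_topology[symmetric]
    by (subst compactin_PiE) auto
  moreover have "closed {y. N y = 1}"
    using continuous_closed_preimage[OF contN, of "{1}"] by (simp add: vimage_def)
  ultimately have comp: "compact (B \<inter> {y. N y = 1})"
    by (rule compact_Int_closed)
  obtain w where w: "w \<in> V" using ne by blast
  have "N (\<lambda>u. of_bool (u = w)) = 1"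
    using fin w by (simp add: N_def of_bool_def if_distrib[of "\<lambda>z. z\<^sup>2"] sum.delta cong: if_cong)
  then have "(\<lambda>u. of_bool (u = w)) \<in> B \<inter> {y. N y = 1}"
    using w by (auto simp: B_def PiE_def Pi_def)
  then obtain x where x: "x \<in> B" "N x = 1"
    and max: "\<And>y. y \<in> B \<Longrightarrow> N y = 1 \<Longrightarrow> Q y \<le> Q x"
    using continuous_attains_sup[OF comp, of Q] continuous_on_subset[OF contQ] by blast
  have x0: "x u \<ge> 0" for u
    using x(1) unfolding B_def by (auto simp: PiE_def Pi_def split: if_splits)
  have "Q y \<le> Q x * N y" for y
  proof (cases "N y = 0")
    case True
    then have "y u = 0" if "u \<in> V" for u
      using that fin unfolding N_def by (subst (asm) sum_nonneg_eq_0_iff) auto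
    then show ?thesis using True by (simp add: Q_def)
  next
    case False
    then have pos: "N y > 0" by (simp add: N_def less_le sum_nonneg)
    define c where "c = sqrt (N y)"
    have c: "c > 0" "c\<^sup>2 = N y" using pos by (auto simp: c_def)
    define z where "z u = (if u \<in> V then \<bar>y u\<bar> / c else 0)" for u
    have "N z = N y / c\<^sup>2"
      by (simp add: N_def z_def power_divide sum_divide_distrib)
    then have Nz: "N z = 1" using c pos by simp
    have "z u \<le> 1" if "u \<in> V" for u
    proof -
      have "(z u)\<^sup>2 \<le> N z" unfolding N_def using that fin by (intro member_le_sum) auto
      then show ?thesis using Nz power2_le_imp_le[of "z u" 1] by simp
    qed
    then have "z \<in> B" using c by (auto simp: B_def z_def PiE_def Pi_def)
    then have "Q z \<le> Q x" using max Nz by blast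
    moreover have "Q y \<le> c\<^sup>2 * Q z"
      unfolding Q_def sum_distrib_left
    proof (intro sum_mono)
      fix u v assume uv: "u \<in> V" "v \<in> V"
      have "A u v * (y u * y v) \<le> A u v * \<bar>y u * y v\<bar>"
        using nonneg by (intro mult_left_mono) auto
      then show "A u v * y u * y v \<le> c\<^sup>2 * (A u v * z u * z v)"
        using uv c(1) by (simp add: z_def abs_mult power2_eq_square mult.assoc)
    qed
    ultimately show ?thesis using c pos
      by (metis mult.commute mult_left_mono order_trans less_imp_le)
  qed
  then show thesis using that[of x] x0 x(2) unfolding Q_def N_def by blast
qed

text \<open>First variation: the form \<open>Q\<close> below is nonnegative and vanishes at
  \<open>x\<close>. Moving from \<open>x\<close> by a suitable multiple of the residual
  \<open>z\<close> would make it negative unless \<open>z\<close> vanishes on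
  \<open>V\<close>.\<close>

lemma Rayleigh_maximizer_eigenvector:
  fixes A :: "'a \<Rightarrow> 'a \<Rightarrow> real"
  assumes fin: "finite V" and sym: "\<And>u v. A u v = A v u"
    and bound: "\<And>y. (\<Sum>u\<in>V. \<Sum>v\<in>V. A u v * y u * y v) \<le> \<mu> * (\<Sum>u\<in>V. (y u)\<^sup>2)"
    and eq: "(\<Sum>u\<in>V. \<Sum>v\<in>V. A u v * x u * x v) = \<mu> * (\<Sum>u\<in>V. (x u)\<^sup>2)"
    and u: "u \<in> V"
  shows "(\<Sum>v\<in>V. A u v * x v) = \<mu> * x u"
proof -
  define Q where "Q y = \<mu> * (\<Sum>u\<in>V. (y u)\<^sup>2) - (\<Sum>u\<in>V. \<Sum>v\<in>V. A u v * y u * y v)"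
    for y :: "'a \<Rightarrow> real"
  define z where "z u = \<mu> * x u - (\<Sum>v\<in>V. A u v * x v)" for u
  define D where "D = (\<Sum>u\<in>V. (z u)\<^sup>2)"
  have D0: "D \<ge> 0" by (simp add: D_def sum_nonneg)
  have cross: "(\<Sum>u\<in>V. \<Sum>v\<in>V. A u v * x u * z v) = (\<Sum>u\<in>V. \<Sum>v\<in>V. A u v * z u * x v)"
    by (subst sum.swap) (simp add: sym mult_ac)
  have Dalt: "D = \<mu> * (\<Sum>u\<in>V. x u * z u) - (\<Sum>u\<in>V. \<Sum>v\<in>V. A u v * z u * x v)"
  proof -
    have "(z u)\<^sup>2 = \<mu> * (x u * z u) - (\<Sum>v\<in>V. A u v * z u * x v)" for u
    proof -
      have "(\<Sum>v\<in>V. A u v * z u * x v) = z u * (\<Sum>v\<in>V. A u v * x v)"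
        by (simp add: sum_distrib_left mult_ac)
      then show ?thesis unfolding power2_eq_square
        by (subst (2) z_def) (simp add: algebra_simps)
    qed
    then show ?thesis by (simp add: D_def sum_subtractf sum_distrib_left)
  qed
  have expand: "Q (\<lambda>u. x u + t * z u) = 2 * t * D + t\<^sup>2 * Q z" for t
  proof -
    have "(\<Sum>u\<in>V. (x u + t * z u)\<^sup>2)
        = (\<Sum>u\<in>V. (x u)\<^sup>2) + 2 * t * (\<Sum>u\<in>V. x u * z u) + t\<^sup>2 * (\<Sum>u\<in>V. (z u)\<^sup>2)"
      by (simp add: power2_eq_square algebra_simps sum.distrib sum_distrib_left)
    moreover have "(\<Sum>u\<in>V. \<Sum>v\<in>V. A u v * (x u + t * z u) * (x v + t * z v))
        = (\<Sum>u\<in>V. \<Sum>v\<in>V. A u v * x u * x v)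
          + t * (\<Sum>u\<in>V. \<Sum>v\<in>V. A u v * x u * z v) + t * (\<Sum>u\<in>V. \<Sum>v\<in>V. A u v * z u * x v)
          + t\<^sup>2 * (\<Sum>u\<in>V. \<Sum>v\<in>V. A u v * z u * z v)"
      by (simp add: power2_eq_square algebra_simps sum.distrib sum_distrib_left)
    ultimately show ?thesis
      unfolding Q_def Dalt cross using eq by (simp add: algebra_simps)
  qed
  have Qpos: "0 \<le> 2 * t * D + t\<^sup>2 * Q z" for t
    using bound[of "\<lambda>u. x u + t * z u"] expand[of t] by (simp add: Q_def)
  have Qz: "Q z \<ge> 0" using bound[of z] by (simp add: Q_def)
  have "D = 0"
  proof (rule ccontr)
    assume "D \<noteq> 0"
    with D0 have "D > 0" by simp
    \<comment> \<open>The added 1 keeps the denominator positive when \<open>Q z = 0\<close>; this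
      \<open>t\<close> leaves \<open>2 * D + t * Q z\<close> greater than \<open>D\<close>.\<close>
    define t where "t = - D / (Q z + 1)"
    have "2 * t * D + t\<^sup>2 * Q z = t * (2 * D + t * Q z)" by (simp add: power2_eq_square algebra_simps)
    moreover have "t < 0" using \<open>D > 0\<close> Qz by (simp add: t_def field_simps)
    moreover have "2 * D + t * Q z > 0"
    proof -
      have "D * Q z / (Q z + 1) \<le> D" using \<open>D > 0\<close> Qz by (simp add: field_simps)
      then show ?thesis using \<open>D > 0\<close> by (simp add: t_def)
    qed
    ultimately have "2 * t * D + t\<^sup>2 * Q z < 0"
      by (simp only: mult_neg_pos)
    then show False using Qpos[of t] by simp
  qed
  then have "(z u)\<^sup>2 = 0"
    using fin u unfolding D_def by (subst (asm) sum_nonneg_eq_0_iff) auto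
  then show ?thesis by (simp add: z_def)
qed

subsection \<open>Weighted counting of books\<close>

locale finite_simple_graph =
  fixes G :: "'a ugraph"
  assumes simple: "simple_graph G"
begin

abbreviation V :: "'a set" where "V \<equiv> verts G"

text \<open>Real 0/1 values turn degrees and codegrees into sums over all of \<open>V\<close>, whose
  order can be swapped and whose terms can be weighted.\<close>

definition adj :: "'a \<Rightarrow> 'a \<Rightarrow> real" where
  "adj u v = of_bool ({u, v} \<in> edges G)"

lemma finV [simp]: "finite V"
  using simple by (simp add: simple_graph_def)

lemma edge_verts: "{u, v} \<in> edges G \<Longrightarrow> u \<in> V \<and> v \<in> V \<and> u \<noteq> v"
  using simple by (auto simp: simple_graph_def)

lemma adj_sym: "adj u v = adj v u"
  by (simp add: adj_def insert_commute)

lemma adj_cases: "adj u v = 0 \<or> adj u v = 1"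
  by (simp add: adj_def)

lemma adj_nonneg [simp]: "adj u v \<ge> 0"
  by (simp add: adj_def)

lemma neighborhood_finite [simp]: "finite (neighborhood G u)"
  by (simp add: neighborhood_def)

lemma in_neighborhood: "w \<in> neighborhood G u \<longleftrightarrow> {u, w} \<in> edges G"
  using edge_verts[of w u] by (auto simp: neighborhood_def insert_commute)

lemma neighborhood_eq: "neighborhood G u = {w \<in> V. {u, w} \<in> edges G}"
  by (auto simp: neighborhood_def insert_commute)

lemma sum_adj: "(\<Sum>v\<in>V. adj u v * f v) = (\<Sum>v\<in>neighborhood G u. f v)"
  unfolding neighborhood_eq by (intro sum.mono_neutral_cong_right) (auto simp: adj_def)

lemma degree_adj: "real (vertex_degree G u) = (\<Sum>v\<in>V. adj u v)"
  using sum_adj[of u "\<lambda>_. 1"] by (simp add: vertex_degree_def)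

lemma edge_triangles_adj: "real (edge_triangles G u v) = (\<Sum>w\<in>V. adj u w * adj v w)"
proof -
  have "(\<Sum>w\<in>V. adj u w * adj v w) = (\<Sum>w\<in>neighborhood G u \<inter> neighborhood G v. 1)"
    unfolding neighborhood_eq by (intro sum.mono_neutral_cong_right) (auto simp: adj_def)
  then show ?thesis by (simp add: edge_triangles_def)
qed

end

text \<open>Entries of \<open>x\<close> may vanish, since \<open>G\<close> may be disconnected; one
  positive entry makes the total weight \<open>S\<close> positive.\<close>

locale nonneg_eigenpair = finite_simple_graph +
  fixes x :: "'a \<Rightarrow> real" and \<mu> :: real
  assumes x_nonneg [simp]: "\<And>u. x u \<ge> 0"
    and x_pos: "\<exists>u\<in>V. x u > 0"
    and eigen: "\<And>u. u \<in> V \<Longrightarrow> (\<Sum>v\<in>V. adj u v * x v) = \<mu> * x u"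
begin

definition S :: real where "S = (\<Sum>u\<in>V. x u)"

definition common_weight :: "'a \<Rightarrow> 'a \<Rightarrow> real" where
  "common_weight u v = (\<Sum>w\<in>V. adj u w * adj v w * x w)"

lemma S_pos: "S > 0"
proof -
  obtain u where "u \<in> V" "x u > 0" using x_pos by blast
  then show ?thesis unfolding S_def by (intro sum_pos2) auto
qed

lemma common_weight_nonneg: "common_weight u v \<ge> 0"
  unfolding common_weight_def by (intro sum_nonneg) auto

text \<open>By the eigenvalue equation, \<open>\<mu> * x u\<close> is the weight of the
  neighbourhood of \<open>u\<close>. This is inclusion-exclusion for two neighbourhoods inside
  \<open>V\<close>, vertexwise a + b - 1 \<le> a b for 0/1 values.\<close>

lemma common_weight_ge:
  assumes "u \<in> V" "v \<in> V"
  shows "\<mu> * (x u + x v) - S \<le> common_weight u v"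
proof -
  have "\<mu> * (x u + x v) - S = (\<Sum>w\<in>V. (adj u w + adj v w - 1) * x w)"
    using assms by (simp add: S_def algebra_simps sum.distrib sum_subtractf flip: eigen)
  also have "\<dots> \<le> common_weight u v"
    unfolding common_weight_def
  proof (intro sum_mono mult_right_mono)
    fix w show "adj u w + adj v w - 1 \<le> adj u w * adj v w"
      using adj_cases[of u w] adj_cases[of v w] by auto
  qed simp
  finally show ?thesis .
qed

text \<open>Vertexwise a + b + c - 1 \<le> a b + b c + a c for 0/1 values, strict exactly when
  \<open>z\<close> is adjacent to none or to all of the three vertices.\<close>

lemma triangle_weight_ge:
  assumes "u \<in> V" "v \<in> V" "w \<in> V"
  shows "\<mu> * (x u + x v + x w) - S \<le> common_weight u v + common_weight v w + common_weight u w"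
proof -
  have "\<mu> * (x u + x v + x w) - S = (\<Sum>z\<in>V. (adj u z + adj v z + adj w z - 1) * x z)"
    using assms by (simp add: S_def algebra_simps sum.distrib sum_subtractf flip: eigen)
  also have "\<dots> \<le> (\<Sum>z\<in>V. (adj u z * adj v z + adj v z * adj w z + adj u z * adj w z) * x z)"
  proof (intro sum_mono mult_right_mono)
    fix z show "adj u z + adj v z + adj w z - 1
        \<le> adj u z * adj v z + adj v z * adj w z + adj u z * adj w z"
      using adj_cases[of u z] adj_cases[of v z] adj_cases[of w z] by auto
  qed simp
  also have "\<dots> = common_weight u v + common_weight v w + common_weight u w"
    by (simp add: common_weight_def algebra_simps sum.distrib)
  finally show ?thesis .
qed

text \<open>Together with its mirror image below, this evaluates sums over ordered edges; it is
  applied with \<open>f\<close> equal to 1, \<open>x\<close> and the square of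
  \<open>x\<close>.\<close>

lemma sum_adj_left: 
  "(\<Sum>u\<in>V. \<Sum>v\<in>V. adj u v * (f u * x v)) = \<mu> * (\<Sum>u\<in>V. f u * x u)"
proof -
  have "(\<Sum>v\<in>V. adj u v * (f u * x v)) = \<mu> * (f u * x u)" if "u \<in> V" for u
    using eigen[OF that] by (simp add: mult.left_commute flip: sum_distrib_left)
  then show ?thesis by (simp add: sum_distrib_left)
qed

lemma sum_adj_right: 
  "(\<Sum>u\<in>V. \<Sum>v\<in>V. adj u v * (x u * f v)) = \<mu> * (\<Sum>u\<in>V. f u * x u)"
  by (subst sum.swap) (use sum_adj_left[of f] in \<open>simp add: adj_sym mult.commute\<close>)

text \<open>Sum \<open>common_weight_ge\<close> over the edges with weights \<open>x u * x v\<close>; the triangle sum of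
  \<open>x u * x v * x w\<close> is at most that of \<open>x u * (x v)\<^sup>2\<close>, in which the edge \<open>{u, v}\<close> can be
  separated from its triangle count.\<close>

lemma booksize_cubic_bound:
  assumes K: "\<And>u v. {u, v} \<in> edges G \<Longrightarrow> real (edge_triangles G u v) \<le> K"
  shows "2 * \<mu> * (\<mu> * (\<Sum>u\<in>V. x u ^ 3)) \<le> \<mu> * (S * (\<Sum>u\<in>V. (x u)\<^sup>2)) + K * (\<mu> * (\<Sum>u\<in>V. x u ^ 3))"
proof -
  define T where "T u v w = adj u v * adj u w * adj v w" for u v w
  have Tsym: "T u v w = T u w v" for u v w
    by (simp add: T_def adj_sym mult_ac)
  have T0: "T u v w \<ge> 0" for u v w by (simp add: T_def)
  have right: "(\<Sum>u\<in>V. \<Sum>v\<in>V. adj u v * (x u * (x v)\<^sup>2)) = \<mu> * (\<Sum>u\<in>V. x u ^ 3)"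
    using sum_adj_right[of "\<lambda>v. (x v)\<^sup>2"] by (simp add: power2_eq_square power3_eq_cube)
  have left: "(\<Sum>u\<in>V. \<Sum>v\<in>V. adj u v * ((x u)\<^sup>2 * x v)) = \<mu> * (\<Sum>u\<in>V. x u ^ 3)"
    using sum_adj_left[of "\<lambda>v. (x v)\<^sup>2"] by (simp add: power2_eq_square power3_eq_cube)
  have mid: "(\<Sum>u\<in>V. \<Sum>v\<in>V. adj u v * (x u * x v)) = \<mu> * (\<Sum>u\<in>V. (x u)\<^sup>2)"
    using sum_adj_left[of x] by (simp add: power2_eq_square)
  have "2 * \<mu> * (\<mu> * (\<Sum>u\<in>V. x u ^ 3)) - S * (\<mu> * (\<Sum>u\<in>V. (x u)\<^sup>2))
      = (\<Sum>u\<in>V. \<Sum>v\<in>V. adj u v * (x u * x v) * (\<mu> * (x u + x v) - S))"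
  proof -
    have "(\<Sum>u\<in>V. \<Sum>v\<in>V. adj u v * (x u * x v) * (\<mu> * (x u + x v) - S))
      = \<mu> * (\<Sum>u\<in>V. \<Sum>v\<in>V. adj u v * ((x u)\<^sup>2 * x v)) + \<mu> * (\<Sum>u\<in>V. \<Sum>v\<in>V. adj u v * (x u * (x v)\<^sup>2))
       - S * (\<Sum>u\<in>V. \<Sum>v\<in>V. adj u v * (x u * x v))"
      by (simp add: algebra_simps sum.distrib sum_subtractf sum_distrib_left power2_eq_square)
    then show ?thesis unfolding left right mid by simp
  qed
  also have "\<dots> \<le> (\<Sum>u\<in>V. \<Sum>v\<in>V. adj u v * (x u * x v) * common_weight u v)"
    by (intro sum_mono mult_left_mono common_weight_ge) auto
  also have "\<dots> = (\<Sum>u\<in>V. \<Sum>v\<in>V. \<Sum>w\<in>V. T u v w * (x u * (x v * x w)))"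
    by (simp add: common_weight_def T_def sum_distrib_left mult_ac)
  \<comment> \<open>AM-GM on the two vertices other than \<open>u\<close>; by \<open>Tsym\<close>
    the two halves of the result agree.\<close>
  also have "\<dots> \<le> (\<Sum>u\<in>V. \<Sum>v\<in>V. \<Sum>w\<in>V. T u v w * (x u * (((x v)\<^sup>2 + (x w)\<^sup>2) / 2)))"
  proof (intro sum_mono mult_left_mono T0 x_nonneg)
    fix v w show "x v * x w \<le> ((x v)\<^sup>2 + (x w)\<^sup>2) / 2"
      using sum_squares_bound[of "x v" "x w"] by simp
  qed
  also have "\<dots> = ((\<Sum>u\<in>V. \<Sum>v\<in>V. \<Sum>w\<in>V. T u v w * (x u * (x v)\<^sup>2))
      + (\<Sum>u\<in>V. \<Sum>v\<in>V. \<Sum>w\<in>V. T u v w * (x u * (x w)\<^sup>2))) / 2"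
    by (simp only: add_divide_distrib distrib_left times_divide_eq_right sum.distrib
        flip: sum_divide_distrib)
  also have "(\<Sum>u\<in>V. \<Sum>v\<in>V. \<Sum>w\<in>V. T u v w * (x u * (x w)\<^sup>2))
      = (\<Sum>u\<in>V. \<Sum>v\<in>V. \<Sum>w\<in>V. T u v w * (x u * (x v)\<^sup>2))"
    by (rule sum.cong[OF refl], subst sum.swap) (simp add: Tsym)
  also have "((\<Sum>u\<in>V. \<Sum>v\<in>V. \<Sum>w\<in>V. T u v w * (x u * (x v)\<^sup>2))
      + (\<Sum>u\<in>V. \<Sum>v\<in>V. \<Sum>w\<in>V. T u v w * (x u * (x v)\<^sup>2))) / 2
      = (\<Sum>u\<in>V. \<Sum>v\<in>V. adj u v * real (edge_triangles G u v) * (x u * (x v)\<^sup>2))"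
    by (simp add: T_def edge_triangles_adj sum_distrib_left sum_distrib_right mult_ac)
  also have "\<dots> \<le> (\<Sum>u\<in>V. \<Sum>v\<in>V. adj u v * K * (x u * (x v)\<^sup>2))"
    by (intro sum_mono mult_right_mono) (auto simp: adj_def K)
  also have "\<dots> = K * (\<mu> * (\<Sum>u\<in>V. x u ^ 3))"
    unfolding right[symmetric] by (simp add: sum_distrib_left mult_ac)
  finally show ?thesis by (simp add: algebra_simps)
qed

text \<open>With this bound on the codegrees the cubic estimate reverses Chebyshev's sum inequality
  for \<open>x\<close> and its square. The gap in Chebyshev's inequality is half the double sum of
  the nonnegative terms \<open>?D u v\<close>, so each of them is 0.\<close>

lemma eigenvector_constant:
  assumes \<mu>: "\<mu> > 0"
    and K: "\<And>u v. {u, v} \<in> edges G \<Longrightarrow> real (edge_triangles G u v) \<le> 2 * \<mu> - real (card V)"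
    and uv: "u \<in> V" "v \<in> V"
  shows "x u = x v"
proof -
  let ?D = "\<lambda>u v. (x u - x v)\<^sup>2 * (x u + x v)"
  have "\<mu> * (real (card V) * (\<Sum>u\<in>V. x u ^ 3)) \<le> \<mu> * (S * (\<Sum>u\<in>V. (x u)\<^sup>2))"
    using booksize_cubic_bound[OF K] by (simp add: algebra_simps)
  then have le: "real (card V) * (\<Sum>u\<in>V. x u ^ 3) \<le> S * (\<Sum>u\<in>V. (x u)\<^sup>2)"
    using \<mu> by simp
  have e: "?D u v = x u ^ 3 + x v ^ 3 - (x u)\<^sup>2 * x v - x u * (x v)\<^sup>2" for u v
    by (simp add: power2_eq_square power3_eq_cube algebra_simps)
  have "(\<Sum>u\<in>V. \<Sum>v\<in>V. ?D u v) = 2 * (real (card V) * (\<Sum>u\<in>V. x u ^ 3) - S * (\<Sum>u\<in>V. (x u)\<^sup>2))"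
    unfolding e by (simp add: sum.distrib sum_subtractf S_def flip: sum_distrib_left sum_distrib_right)
  with le have "(\<Sum>u\<in>V. \<Sum>v\<in>V. ?D u v) \<le> 0" by simp
  moreover have D0: "?D u v \<ge> 0" for u v by simp
  ultimately have z: "(\<Sum>u\<in>V. \<Sum>v\<in>V. ?D u v) = 0"
    by (intro antisym sum_nonneg D0)
  have "\<forall>u\<in>V. (\<Sum>v\<in>V. ?D u v) = 0"
    using z by (subst (asm) sum_nonneg_eq_0_iff) (auto intro!: sum_nonneg)
  then have "(\<Sum>v\<in>V. ?D u v) = 0" using uv by blast
  then have "?D u v = 0" using uv by (subst (asm) sum_nonneg_eq_0_iff) auto
  \<comment> \<open>Either the entries agree, or their sum is 0 and nonnegativity makes both of them
    0.\<close>
  then show ?thesis using x_nonneg[of u] x_nonneg[of v] by (auto simp del: x_nonneg)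
qed

text \<open>Sum \<open>triangle_weight_ge\<close> over all triangles. What separates the result from the claim is the
  sum over the edges of the deficiency \<open>K - t u v\<close> times \<open>f u v\<close> below, where the condition on
  \<open>K\<close> makes \<open>f\<close> nonnegative also on edges of small weight.\<close>

lemma book_edge_bound:
  assumes K: "\<And>u v. {u, v} \<in> edges G \<Longrightarrow> real (edge_triangles G u v) \<le> K"
    and K0: "K > 0" and K\<mu>: "\<mu> \<le> 3 * K"
  shows "3 * \<mu> * (\<mu> - K) \<le> (\<Sum>u\<in>V. \<Sum>v\<in>V. adj u v)"
proof -
  \<comment> \<open>All sums run over ordered tuples: \<open>m\<close> is twice the number of edges
    and \<open>N\<close> six times the number of triangles.\<close>
  define m where "m = (\<Sum>u\<in>V. \<Sum>v\<in>V. adj u v)"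
  define t where "t u v = real (edge_triangles G u v)" for u v
  define T where "T u v w = adj u v * adj u w * adj v w" for u v w
  define X where "X = (\<Sum>u\<in>V. \<Sum>v\<in>V. \<Sum>w\<in>V. T u v w * x u)"
  define N where "N = (\<Sum>u\<in>V. \<Sum>v\<in>V. \<Sum>w\<in>V. T u v w)"
  define R where "R = (\<Sum>u\<in>V. \<Sum>v\<in>V. adj u v * t u v * common_weight u v)"
  have Tsym: "T u v w = T u w v" "T u v w = T v u w" for u v w
    by (simp_all add: T_def adj_sym mult_ac)
  have T0: "T u v w \<ge> 0" for u v w by (simp add: T_def)
  have Tt: "(\<Sum>w\<in>V. T u v w) = adj u v * t u v" for u v
    by (simp add: T_def t_def edge_triangles_adj sum_distrib_left mult_ac)
  have swap12: "(\<Sum>u\<in>V. \<Sum>v\<in>V. \<Sum>w\<in>V. T u v w * f v u w) = (\<Sum>u\<in>V. \<Sum>v\<in>V. \<Sum>w\<in>V. T u v w * f u v w)" for f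
    by (subst sum.swap) (simp add: Tsym(2))
  have swap23: "(\<Sum>u\<in>V. \<Sum>v\<in>V. \<Sum>w\<in>V. T u v w * f u w v) = (\<Sum>u\<in>V. \<Sum>v\<in>V. \<Sum>w\<in>V. T u v w * f u v w)" for f
    by (rule sum.cong[OF refl], subst sum.swap) (simp add: Tsym(1))
  have Xv: "(\<Sum>u\<in>V. \<Sum>v\<in>V. \<Sum>w\<in>V. T u v w * x v) = X"
    unfolding X_def by (rule swap12)
  have Xw: "(\<Sum>u\<in>V. \<Sum>v\<in>V. \<Sum>w\<in>V. T u v w * x w) = X"
    unfolding Xv[symmetric] by (rule swap23)
  have Rw: "(\<Sum>u\<in>V. \<Sum>v\<in>V. \<Sum>w\<in>V. T u v w * common_weight u v) = R"
    by (simp add: R_def Tt flip: sum_distrib_right)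
  have Rv: "(\<Sum>u\<in>V. \<Sum>v\<in>V. \<Sum>w\<in>V. T u v w * common_weight u w) = R"
    unfolding Rw[symmetric] by (rule swap23)
  have Ru: "(\<Sum>u\<in>V. \<Sum>v\<in>V. \<Sum>w\<in>V. T u v w * common_weight v w) = R"
    unfolding Rv[symmetric] by (rule swap12)
  have "(\<Sum>u\<in>V. \<Sum>v\<in>V. \<Sum>w\<in>V. T u v w * (\<mu> * (x u + x v + x w) - S))
      \<le> (\<Sum>u\<in>V. \<Sum>v\<in>V. \<Sum>w\<in>V. T u v w *
            (common_weight u v + common_weight v w + common_weight u w))"
    by (intro sum_mono mult_left_mono triangle_weight_ge T0)
  also have "\<dots> = 3 * R"
    by (simp only: distrib_left sum.distrib Ru Rv Rw)
  also have "(\<Sum>u\<in>V. \<Sum>v\<in>V. \<Sum>w\<in>V. T u v w * (\<mu> * (x u + x v + x w) - S))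
      = \<mu> * ((\<Sum>u\<in>V. \<Sum>v\<in>V. \<Sum>w\<in>V. T u v w * x u) + (\<Sum>u\<in>V. \<Sum>v\<in>V. \<Sum>w\<in>V. T u v w * x v)
         + (\<Sum>u\<in>V. \<Sum>v\<in>V. \<Sum>w\<in>V. T u v w * x w)) - S * N"
    by (simp add: N_def algebra_simps sum.distrib sum_subtractf sum_distrib_left)
  also have "\<dots> = 3 * \<mu> * X - S * N"
    by (simp add: Xv Xw flip: X_def)
  finally have tri: "3 * \<mu> * X - S * N \<le> 3 * R" .

  have cW: "(\<Sum>u\<in>V. \<Sum>v\<in>V. adj u v * common_weight u v) = X"
    unfolding Xw[symmetric] by (simp add: common_weight_def T_def sum_distrib_left mult_ac)
  have tN: "(\<Sum>u\<in>V. \<Sum>v\<in>V. adj u v * t u v) = N"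
    by (simp add: N_def Tt)
  have tX: "(\<Sum>u\<in>V. \<Sum>v\<in>V. adj u v * t u v * x u) = X"
    by (simp add: X_def Tt flip: sum_distrib_right)
  have tX': "(\<Sum>u\<in>V. \<Sum>v\<in>V. adj u v * t u v * x v) = X"
    unfolding Xv[symmetric] by (simp add: Tt flip: sum_distrib_right)
  have aX: "(\<Sum>u\<in>V. \<Sum>v\<in>V. adj u v * x u) = \<mu> * S"
    using sum_adj_right[of "\<lambda>_. 1"] by (simp add: S_def)
  have aX': "(\<Sum>u\<in>V. \<Sum>v\<in>V. adj u v * x v) = \<mu> * S"
    using sum_adj_left[of "\<lambda>_. 1"] by (simp add: S_def)
  \<comment> \<open>The coefficient \<open>3 * (\<mu> - K)\<close> is chosen so that, on expanding
    the deficiency sum, the multiples of \<open>X\<close> add up to \<open>3 * \<mu> * X\<close>,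
    which \<open>tri\<close> absorbs together with \<open>S * N\<close> and
    \<open>3 * R\<close>.\<close>
  define f where "f u v = S - 3 * (\<mu> - K) * ((x u + x v) / 2) + 3 * common_weight u v" for u v
  have f0: "f u v \<ge> 0" if "u \<in> V" "v \<in> V" for u v
  proof -
    \<comment> \<open>With s = \<open>x u + x v\<close> and C = \<open>common_weight u v\<close>,
      the value \<open>2 * f u v\<close> is 2 (S - \<mu> s + C) + (3 K - \<mu>) s + 4 C, a sum of
      nonnegative terms.\<close>
    have "(3 * K - \<mu>) * (x u + x v) \<ge> 0" using K\<mu> by (intro mult_nonneg_nonneg) auto
    moreover have "2 * f u v
        = 2 * S - 3 * (\<mu> * (x u + x v)) + 3 * (K * (x u + x v)) + 6 * common_weight u v"
      by (simp add: f_def field_simps)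
    ultimately show ?thesis
      using common_weight_ge[OF that] common_weight_nonneg[of u v]
      by (simp add: left_diff_distrib mult.assoc)
  qed
  have "0 \<le> (\<Sum>u\<in>V. \<Sum>v\<in>V. adj u v * (K - t u v) * f u v)"
  proof (intro sum_nonneg)
    fix u v assume "u \<in> V" "v \<in> V"
    then show "0 \<le> adj u v * (K - t u v) * f u v"
      using K[of u v] f0[of u v] by (auto simp: adj_def t_def)
  qed
  also have "\<dots> = K * (S * (\<Sum>u\<in>V. \<Sum>v\<in>V. adj u v)
        - 3 * (\<mu> - K) / 2 * ((\<Sum>u\<in>V. \<Sum>v\<in>V. adj u v * x u) + (\<Sum>u\<in>V. \<Sum>v\<in>V. adj u v * x v))
        + 3 * (\<Sum>u\<in>V. \<Sum>v\<in>V. adj u v * common_weight u v))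
      - (S * (\<Sum>u\<in>V. \<Sum>v\<in>V. adj u v * t u v)
        - 3 * (\<mu> - K) / 2 * ((\<Sum>u\<in>V. \<Sum>v\<in>V. adj u v * t u v * x u) + (\<Sum>u\<in>V. \<Sum>v\<in>V. adj u v * t u v * x v))
        + 3 * R)"
  proof -
    have "adj u v * (K - t u v) * f u v = 
      K * (S * adj u v - 3 * (\<mu> - K) / 2 * (adj u v * x u + adj u v * x v) + 3 * (adj u v * common_weight u v))
      - (S * (adj u v * t u v) - 3 * (\<mu> - K) / 2 * (adj u v * t u v * x u + adj u v * t u v * x v)
       + 3 * (adj u v * t u v * common_weight u v))" for u v
      by (simp add: f_def field_simps)
    then show ?thesis
      unfolding R_def by (simp only: sum.distrib sum_subtractf flip: sum_distrib_left)
  qed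
  also have "\<dots> = K * (S * m) - 3 * (\<mu> - K) * (\<mu> * S) * K + 3 * \<mu> * X - S * N - 3 * R"
    unfolding cW tN tX tX' aX aX' m_def[symmetric] by (simp add: field_simps)
  also have "\<dots> \<le> K * (S * m) - 3 * (\<mu> - K) * (\<mu> * S) * K" using tri by simp
  finally have "0 \<le> (K * S) * (m - 3 * \<mu> * (\<mu> - K))" by (simp add: algebra_simps)
  moreover have "K * S > 0" using K0 S_pos by simp
  ultimately show ?thesis unfolding m_def by (simp only: zero_le_mult_iff) linarith
qed

end

subsection \<open>The spectral radius as a Rayleigh maximum\<close>

context nonneg_eigenpair
begin

text \<open>Summing the eigenvalue equation over all vertices weights each entry by its
  degree.\<close>

lemma regular_eigenvalue:
  assumes "regular G d"
  shows "\<mu> = real d"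
proof -
  have "\<mu> * S = (\<Sum>u\<in>V. \<Sum>v\<in>V. adj u v * x v)"
    using sum_adj_left[of "\<lambda>_. 1"] by (simp add: S_def)
  also have "\<dots> = (\<Sum>v\<in>V. (\<Sum>u\<in>V. adj v u) * x v)"
    by (subst sum.swap) (simp add: sum_distrib_right adj_sym)
  also have "\<dots> = real d * S"
    using assms by (simp add: S_def regular_def sum_distrib_left flip: degree_adj)
  finally show ?thesis using S_pos by simp
qed

end

context finite_simple_graph
begin

text \<open>The maximal Rayleigh quotient is an eigenvalue with a nonnegative eigenvector, and it
  bounds the modulus of every complex eigenvalue: pass to the moduli of the entries of an
  eigenvector. Hence it is the spectral radius.\<close>

lemma Perron_eigenpair:
  assumes "V \<noteq> {}"
  obtains x where "nonneg_eigenpair G x (graph_radius G)"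
    and "\<And>y. (\<Sum>u\<in>V. \<Sum>v\<in>V. adj u v * y u * y v) \<le> graph_radius G * (\<Sum>u\<in>V. (y u)\<^sup>2)"
proof -
  obtain x where x0: "\<And>u. x u \<ge> 0" and x1: "(\<Sum>u\<in>V. (x u)\<^sup>2) = 1"
    and Q: "\<And>y. (\<Sum>u\<in>V. \<Sum>v\<in>V. adj u v * y u * y v)
          \<le> (\<Sum>u\<in>V. \<Sum>v\<in>V. adj u v * x u * x v) * (\<Sum>u\<in>V. (y u)\<^sup>2)"
    using nonneg_Rayleigh_maximizer[of V adj] assms by auto
  define \<mu> where "\<mu> = (\<Sum>u\<in>V. \<Sum>v\<in>V. adj u v * x u * x v)"
  have eig: "(\<Sum>v\<in>V. adj u v * x v) = \<mu> * x u" if "u \<in> V" for u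
    by (rule Rayleigh_maximizer_eigenvector[where x = x, OF finV adj_sym _ _ that])
      (use Q x1 in \<open>simp_all add: \<mu>_def\<close>)
  have xpos: "\<exists>u\<in>V. x u > 0"
  proof (rule ccontr)
    assume "\<not> ?thesis"
    then have "(\<Sum>u\<in>V. (x u)\<^sup>2) = 0"
      using x0 by (intro sum.neutral ballI) (simp add: order_antisym not_less)
    with x1 show False by simp
  qed
  obtain vs where vs: "distinct vs" "set vs = V"
    using finite_distinct_list[OF finV] by metis
  define n where "n = length vs"
  define M where "M = adjacency_matrix G vs"
  have M: "M \<in> carrier_mat n n" by (simp add: M_def adjacency_matrix_def n_def)
  have n0: "n > 0" using vs assms by (auto simp: n_def)
  have bij: "bij_betw ((!) vs) {..<n} V"
    using vs by (auto intro!: bij_betw_nth simp: n_def)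
  have reindex: "(\<Sum>u\<in>V. f u) = (\<Sum>i<n. f (vs ! i))" for f :: "'a \<Rightarrow> 'b :: comm_monoid_add"
    using sum.reindex_bij_betw[OF bij, of f] by simp
  have Mij: "M $$ (i, j) = complex_of_real (adj (vs ! i) (vs ! j))" if "i < n" "j < n" for i j
    using that by (simp add: M_def adjacency_matrix_def n_def adj_def)
  have Mv: "(M *\<^sub>v z) $ i = (\<Sum>j<n. complex_of_real (adj (vs ! i) (vs ! j)) * z $ j)"
    if "i < n" "z \<in> carrier_vec n" for i z
    using that M by (auto simp: scalar_prod_def atLeast0LessThan Mij intro!: sum.cong)
  have nth: "vs ! i \<in> V" if "i < n" for i
    using bij that by (auto simp: bij_betw_def)
  have "spectral_radius M = \<mu>"
  proof (rule antisym)
    obtain k where k: "k \<in> spectrum M" "spectral_radius M = norm k"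
      using spectral_radius_mem_max(1)[OF M n0] by blast
    then obtain z where z: "z \<in> carrier_vec n" "z \<noteq> 0\<^sub>v n" "M *\<^sub>v z = k \<cdot>\<^sub>v z"
      using M by (auto simp: spectrum_def eigenvalue_def eigenvector_def)
    \<comment> \<open>\<open>idx\<close> carries the vector indexed by list positions back to the
      vertices, where the Rayleigh bound \<open>Q\<close> applies.\<close>
    define idx where "idx = inv_into {..<n} ((!) vs)"
    have idx: "idx (vs ! i) = i" if "i < n" for i
      using bij_betw_inv_into_left[OF bij] that by (simp add: idx_def)
    define N where "N = (\<Sum>i<n. (norm (z $ i))\<^sup>2)"
    obtain i where "i < n" "z $ i \<noteq> 0"
      using z(1,2) by (metis carrier_vecD eq_vecI index_zero_vec)
    then have N0: "N > 0" unfolding N_def by (intro sum_pos2[of _ i]) auto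
    have "norm k * N = (\<Sum>i<n. norm (z $ i) * norm (k * z $ i))"
      by (simp add: N_def sum_distrib_left norm_mult power2_eq_square mult_ac)
    also have "\<dots> = (\<Sum>i<n. norm (z $ i) * norm ((M *\<^sub>v z) $ i))"
      using z(1,3) by (intro sum.cong) auto
    also have "\<dots> \<le> (\<Sum>i<n. norm (z $ i) * (\<Sum>j<n. adj (vs ! i) (vs ! j) * norm (z $ j)))"
    proof (intro sum_mono mult_left_mono)
      fix i assume "i \<in> {..<n}"
      then have "norm ((M *\<^sub>v z) $ i)
          \<le> (\<Sum>j<n. norm (complex_of_real (adj (vs ! i) (vs ! j)) * z $ j))"
        using z(1) by (simp add: Mv norm_sum)
      then show "norm ((M *\<^sub>v z) $ i) \<le> (\<Sum>j<n. adj (vs ! i) (vs ! j) * norm (z $ j))"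
        by (simp add: norm_mult)
    qed simp
    also have "\<dots> = (\<Sum>u\<in>V. \<Sum>v\<in>V. adj u v * norm (z $ idx u) * norm (z $ idx v))"
      by (simp add: reindex idx sum_distrib_left mult_ac)
    also have "\<dots> \<le> \<mu> * (\<Sum>u\<in>V. (norm (z $ idx u))\<^sup>2)"
      unfolding \<mu>_def by (rule Q)
    also have "\<dots> = \<mu> * N" by (simp add: reindex idx N_def)
    finally show "spectral_radius M \<le> \<mu>" using N0 k(2) by simp
  next
    \<comment> \<open>The real maximiser, read as a complex vector, puts \<open>\<mu>\<close> into
      the spectrum.\<close>
    define y where "y = vec n (\<lambda>i. complex_of_real (x (vs ! i)))"
    have yc: "y \<in> carrier_vec n" by (simp add: y_def)
    have "M *\<^sub>v y = complex_of_real \<mu> \<cdot>\<^sub>v y"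
    proof (rule eq_vecI)
      fix i assume "i < dim_vec (complex_of_real \<mu> \<cdot>\<^sub>v y)"
      then have i: "i < n" by (simp add: y_def)
      have "(M *\<^sub>v y) $ i = complex_of_real (\<Sum>v\<in>V. adj (vs ! i) v * x v)"
        using i yc by (simp add: Mv y_def reindex)
      then show "(M *\<^sub>v y) $ i = (complex_of_real \<mu> \<cdot>\<^sub>v y) $ i"
        using i by (simp add: eig nth y_def)
    qed (use M in \<open>simp add: y_def\<close>)
    moreover have "y \<noteq> 0\<^sub>v n"
    proof
      assume y0: "y = 0\<^sub>v n"
      obtain u where "u \<in> V" "x u > 0" using xpos by blast
      moreover from this obtain i where "i < n" "u = vs ! i" using bij by (auto simp: bij_betw_def)
      ultimately have "y $ i \<noteq> 0" "i < n" by (simp_all add: y_def)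
      then show False using y0 by simp
    qed
    ultimately have "complex_of_real \<mu> \<in> spectrum M"
      using M yc by (auto simp: spectrum_def eigenvalue_def eigenvector_def)
    then have "norm (complex_of_real \<mu>) \<le> spectral_radius M"
      by (intro spectral_radius_mem_max(2)[OF M n0] imageI)
    then show "\<mu> \<le> spectral_radius M" by simp
  qed
  then have rad: "graph_radius G = \<mu>"
    using graph_radius_eq[OF vs] by (simp add: M_def)
  show thesis
  proof (rule that)
    show "nonneg_eigenpair G x (graph_radius G)"
      unfolding rad by unfold_locales (use x0 xpos eig in auto)
  qed (use Q rad \<mu>_def in simp)
qed

text \<open>The Rayleigh quotient of the all-ones vector is the average degree.\<close>

lemma sum_adj_le_graph_radius:
  assumes "V \<noteq> {}"
  shows "(\<Sum>u\<in>V. \<Sum>v\<in>V. adj u v) \<le> graph_radius G * real (card V)"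
proof -
  obtain x where "\<And>y. (\<Sum>u\<in>V. \<Sum>v\<in>V. adj u v * y u * y v) \<le> graph_radius G * (\<Sum>u\<in>V. (y u)\<^sup>2)"
    using Perron_eigenpair[OF assms] by blast
  from this[of "\<lambda>_. 1"] show ?thesis by simp
qed

text \<open>Here the all-ones vector attains the maximal Rayleigh quotient, so it is an eigenvector
  and all degrees agree.\<close>

lemma regular_if_sum_adj_ge:
  assumes "V \<noteq> {}" and ge: "graph_radius G * real (card V) \<le> (\<Sum>u\<in>V. \<Sum>v\<in>V. adj u v)"
  obtains d where "regular G d" "real d = graph_radius G"
proof -
  obtain x where Q: "\<And>y. (\<Sum>u\<in>V. \<Sum>v\<in>V. adj u v * y u * y v) \<le> graph_radius G * (\<Sum>u\<in>V. (y u)\<^sup>2)"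
    using Perron_eigenpair[OF assms(1)] by blast
  have deg: "real (vertex_degree G u) = graph_radius G" if "u \<in> V" for u
  proof -
    have "(\<Sum>v\<in>V. adj u v * 1) = graph_radius G * 1"
      by (rule Rayleigh_maximizer_eigenvector[where x = "\<lambda>_. 1", OF finV adj_sym Q _ that])
        (use ge Q[of "\<lambda>_. 1"] in simp)
    then show ?thesis by (simp add: degree_adj)
  qed
  obtain v where "v \<in> V" using assms(1) by blast
  show thesis
  proof (rule that)
    show "regular G (vertex_degree G v)"
      unfolding regular_def using deg \<open>v \<in> V\<close> by (metis of_nat_eq_iff)
  qed (use deg \<open>v \<in> V\<close> in simp)
qed

lemma graph_radius_regular:
  assumes "V \<noteq> {}" "regular G d"
  shows "graph_radius G = real d"
  using Perron_eigenpair[OF assms(1)] nonneg_eigenpair.regular_eigenvalue[OF _ assms(2)] by metis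

end

section \<open>The spectral radius of the bipartite Turan graph\<close>

lemma turan_edge_iff: "{u, v} \<in> edges (turan n r) \<longleftrightarrow> u < n \<and> v < n \<and> u mod r \<noteq> v mod r"
  by (auto simp: turan_def doubleton_eq_iff)

lemma verts_turan [simp]: "verts (turan n r) = {..<n}"
  by (simp add: turan_def)

text \<open>A bound by the average degree, valid for both parities; the 1 is lost only for odd
  \<open>n\<close>.\<close>

lemma graph_radius_turan_2_ge:
  assumes "n > 0"
  shows "2 * (real n * graph_radius (turan n 2)) \<ge> (real n)\<^sup>2 - 1"
proof -
  interpret T: finite_simple_graph "turan n 2"
    by unfold_locales (rule simple_graph_turan)
  define s where "s = (\<Sum>u<n. (-1) ^ u :: real)"
  have "s = of_bool (odd n)"
    unfolding s_def by (induction n) auto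
  then have s: "s\<^sup>2 \<le> 1" by simp
  \<comment> \<open>Writing adjacency with signs makes the double sum factor into the square of
    \<open>s\<close>.\<close>
  have adj: "2 * T.adj u v = 1 - (-1) ^ u * (-1) ^ v" if "u < n" "v < n" for u v
    using that unfolding T.adj_def turan_edge_iff
    by (cases "even u"; cases "even v") (simp_all add: even_iff_mod_2_eq_zero odd_iff_mod_2_eq_one)
  have "2 * (\<Sum>u<n. \<Sum>v<n. T.adj u v) = (\<Sum>u<n. \<Sum>v<n. 1 - (-1) ^ u * (-1) ^ v)"
    unfolding sum_distrib_left by (intro sum.cong refl) (simp add: adj)
  also have "\<dots> = (real n)\<^sup>2 - s\<^sup>2"
    by (simp add: sum_subtractf s_def power2_eq_square sum_product)
  finally have "2 * (\<Sum>u<n. \<Sum>v<n. T.adj u v) \<ge> (real n)\<^sup>2 - 1" using s by simp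
  moreover have "(\<Sum>u<n. \<Sum>v<n. T.adj u v) \<le> graph_radius (turan n 2) * real n"
    using T.sum_adj_le_graph_radius assms by (simp add: lessThan_empty_iff)
  ultimately show ?thesis by (simp add: mult.commute)
qed

subsection \<open>Turan graphs and triangles in regular graphs\<close>

lemma card_residue_class:
  assumes "r dvd n" "c < r"
  shows "card {i. i < n \<and> i mod r = c} = n div r"
proof -
  have "{i. i < n \<and> i mod r = c} = (\<lambda>j. c + r * j) ` {..<n div r}"
  proof (intro equalityI subsetI)
    fix i assume i: "i \<in> {i. i < n \<and> i mod r = c}"
    then have "i = c + r * (i div r)" by (metis (mono_tags) mem_Collect_eq mod_mult_div_eq)
    moreover have "i div r < n div r"
      using i assms by (auto elim!: dvdE simp: div_less_iff_less_mult mult.commute)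
    ultimately show "i \<in> (\<lambda>j. c + r * j) ` {..<n div r}" by blast
  next
    fix i assume "i \<in> (\<lambda>j. c + r * j) ` {..<n div r}"
    then obtain j where j: "j < n div r" "i = c + r * j" by auto
    have "c + r * j < r * Suc j" using assms(2) by simp
    also have "\<dots> \<le> r * (n div r)" using j(1) by (intro mult_le_mono2) simp
    also have "\<dots> = n" using assms(1) by simp
    finally show "i \<in> {i. i < n \<and> i mod r = c}" using j(2) assms(2) by simp
  qed
  moreover have "inj_on (\<lambda>j. c + r * j) {..<n div r}"
    using assms(2) by (auto simp: inj_on_def)
  ultimately show ?thesis by (simp add: card_image)
qed

context finite_simple_graph
begin

section \<open>Booksize, codegrees and unions of neighbourhoods\<close>

lemma finite_edge_triangles: "finite {edge_triangles G u v | u v. {u, v} \<in> edges G}"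
proof (rule finite_subset)
  show "{edge_triangles G u v | u v. {u, v} \<in> edges G}
      \<subseteq> (\<lambda>(u, v). edge_triangles G u v) ` (V \<times> V)"
    using edge_verts by force
qed simp

lemma edge_triangles_le_booksize:
  assumes "{u, v} \<in> edges G"
  shows "edge_triangles G u v \<le> booksize G"
  unfolding booksize_def using assms finite_edge_triangles by (intro Max_ge) auto

text \<open>The given edge makes the set in the definition of \<open>booksize\<close> nonempty, so
  that \<open>Max\<close> is one of its elements.\<close>

lemma booksize_attained:
  assumes "{a, b} \<in> edges G"
  obtains u v where "{u, v} \<in> edges G" "edge_triangles G u v = booksize G"
proof -
  have "booksize G \<in> {edge_triangles G u v | u v. {u, v} \<in> edges G}"
    unfolding booksize_def using assms finite_edge_triangles by (intro Max_in) auto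
  then show thesis using that by auto
qed

lemma card_neighborhood_Un:
  "card (neighborhood G u \<union> neighborhood G v) + edge_triangles G u v
    = vertex_degree G u + vertex_degree G v"
  unfolding edge_triangles_def vertex_degree_def
  by (rule card_Un_Int[symmetric]) simp_all

lemma neighborhood_subset: "neighborhood G u \<subseteq> V"
  by (auto simp: neighborhood_def)

text \<open>In a regular graph of degree above half the order, this puts every edge into a
  triangle.\<close>

lemma edge_triangles_ge: "vertex_degree G u + vertex_degree G v \<le> card V + edge_triangles G u v"
proof -
  have "card (neighborhood G u \<union> neighborhood G v) \<le> card V"
    using neighborhood_subset by (intro card_mono) auto
  then show ?thesis using card_neighborhood_Un[of u v] by simp
qed

text \<open>All classes have size \<open>n div r\<close>. A neighbourhood is the complement of one
  class, and a common neighbourhood of adjacent vertices the complement of two disjoint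
  ones.\<close>

lemma iso_turan_parameters:
  assumes iso: "graph_iso G (turan n r)" and r: "r > 0" "r dvd n"
  shows "regular G (n - n div r)"
    and "{u, v} \<in> edges G \<Longrightarrow> edge_triangles G u v = n - 2 * (n div r)"
proof -
  obtain f where f: "bij_betw f V {..<n}"
    and "\<And>u v. u \<in> V \<Longrightarrow> v \<in> V \<Longrightarrow> {u, v} \<in> edges G \<longleftrightarrow> {f u, f v} \<in> edges (turan n r)"
    using iso unfolding graph_iso_def by auto
  then have fe: "{u, v} \<in> edges G \<longleftrightarrow> f u mod r \<noteq> f v mod r" if "u \<in> V" "v \<in> V" for u v
    using that by (auto simp: turan_edge_iff bij_betw_def)
  have transport: "card {v \<in> V. P (f v)} = card {i. i < n \<and> P i}" for P
  proof -
    have "f ` {v \<in> V. P (f v)} = {i. i < n \<and> P i}" "inj_on f {v \<in> V. P (f v)}"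
      using f by (auto simp: bij_betw_def inj_on_def)
    then show ?thesis by (metis card_image)
  qed
  have nb: "neighborhood G u = {v \<in> V. f v mod r \<noteq> f u mod r}" if "u \<in> V" for u
    using that by (auto simp: neighborhood_def fe)
  have card_cls: "card {i. i < n \<and> i mod r = c mod r} = n div r" for c
    using r by (intro card_residue_class) auto
  show "regular G (n - n div r)"
    unfolding regular_def vertex_degree_def
  proof
    fix u assume u: "u \<in> V"
    have "{i. i < n \<and> i mod r \<noteq> f u mod r} = {..<n} - {i. i < n \<and> i mod r = f u mod r}" by auto
    then show "card (neighborhood G u) = n - n div r"
      using u by (simp add: nb transport[of "\<lambda>i. i mod r \<noteq> f u mod r"] card_cls card_Diff_subset subset_eq)
  qed
  show "edge_triangles G u v = n - 2 * (n div r)" if e: "{u, v} \<in> edges G"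
  proof -
    have uv: "u \<in> V" "v \<in> V" using edge_verts[OF e] by auto
    let ?C = "\<lambda>c. {i. i < n \<and> i mod r = c mod r}"
    have "neighborhood G u \<inter> neighborhood G v
        = {w \<in> V. f w mod r \<noteq> f u mod r \<and> f w mod r \<noteq> f v mod r}"
      using uv by (auto simp: nb)
    moreover have "{i. i < n \<and> (i mod r \<noteq> f u mod r \<and> i mod r \<noteq> f v mod r)}
        = {..<n} - (?C (f u) \<union> ?C (f v))" by auto
    moreover have "card (?C (f u) \<union> ?C (f v)) = 2 * (n div r)"
      using e uv by (subst card_Un_disjoint) (auto simp: card_cls fe)
    moreover have "card ({..<n} - (?C (f u) \<union> ?C (f v))) = n - card (?C (f u) \<union> ?C (f v))"
      by (subst card_Diff_subset) auto
    ultimately show ?thesis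
      unfolding edge_triangles_def
      by (simp only: transport[of "\<lambda>i. i mod r \<noteq> f u mod r \<and> i mod r \<noteq> f v mod r"])
  qed
qed

text \<open>No vertex misses both ends of an edge, so non-adjacency is an equivalence relation; by
  regularity its classes all have size \<open>card V - d\<close>.\<close>

lemma iso_turan_if_neighborhoods_cover:
  assumes ne: "V \<noteq> {}" and reg: "regular G d"
    and cover: "\<And>u v. {u, v} \<in> edges G \<Longrightarrow> neighborhood G u \<union> neighborhood G v = V"
  obtains r where "r * (card V - d) = card V" "graph_iso G (turan (card V) r)"
proof -
  define cls where "cls u = V - neighborhood G u" for u
  define s where "s = card V - d"
  have cls_self: "u \<in> cls u" if "u \<in> V" for u
    using that edge_verts[of u u] by (auto simp: cls_def in_neighborhood)
  have card_cls: "card (cls u) = s" if "u \<in> V" for u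
    using that reg neighborhood_subset[of u]
    by (simp add: cls_def s_def card_Diff_subset regular_def vertex_degree_def)
  \<comment> \<open>Transitivity: if \<open>u\<close> and \<open>w\<close> were adjacent,
    \<open>v\<close> would have to be adjacent to one of them.\<close>
  have cls_subset: "cls v \<subseteq> cls u" if "v \<in> cls u" for u v
  proof
    fix w assume w: "w \<in> cls v"
    show "w \<in> cls u"
    proof (rule ccontr)
      assume "w \<notin> cls u"
      then have "{u, w} \<in> edges G" using w by (auto simp: cls_def in_neighborhood)
      then have "v \<in> neighborhood G u \<union> neighborhood G w" using cover that by (auto simp: cls_def)
      then show False using that w by (auto simp: cls_def in_neighborhood insert_commute)
    qed
  qed
  have cls_sym: "u \<in> cls v" if "v \<in> cls u" "u \<in> V" for u v
    using that by (auto simp: cls_def in_neighborhood insert_commute)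
  have cls_eq: "cls v = cls u" if "v \<in> cls u" "u \<in> V" for u v
    using cls_subset[OF that(1)] cls_subset[OF cls_sym[OF that]] by blast
  define P where "P = cls ` V"
  define r where "r = card P"
  have finP: "finite P" by (simp add: P_def)
  have "s * card P = card (\<Union>P)"
  proof (rule card_partition[OF finP])
    show "finite (\<Union>P)" by (auto simp: P_def cls_def)
    show "card c = s" if "c \<in> P" for c using that card_cls by (auto simp: P_def)
    show "c1 \<inter> c2 = {}" if "c1 \<in> P" "c2 \<in> P" "c1 \<noteq> c2" for c1 c2
      using that cls_eq unfolding P_def by blast
  qed
  moreover have "\<Union>P = V" using cls_self by (auto simp: P_def cls_def)
  ultimately have rs: "r * s = card V" by (simp add: r_def mult.commute)
  obtain h where h: "bij_betw h P {..<r}"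
    using ex_bij_betw_finite_nat[OF finP] by (auto simp: r_def atLeast0LessThan)
  have "\<exists>g. bij_betw g c {..<s}" if "c \<in> P" for c
    using that card_cls ex_bij_betw_finite_nat[of c] by (auto simp: P_def cls_def atLeast0LessThan)
  then obtain g where g: "\<And>c. c \<in> P \<Longrightarrow> bij_betw (g c) c {..<s}" by metis
  \<comment> \<open>The residue modulo \<open>r\<close> encodes the class of \<open>v\<close>, the
    quotient its position within the class.\<close>
  define f where "f v = h (cls v) + r * g (cls v) v" for v
  have inP: "cls v \<in> P" if "v \<in> V" for v using that by (simp add: P_def)
  have hr: "h (cls v) < r" if "v \<in> V" for v using h inP[OF that] by (auto simp: bij_betw_def)
  have gs: "g (cls v) v < s" if "v \<in> V" for v
    using g[OF inP[OF that]] cls_self[OF that] by (auto simp: bij_betw_def)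
  have fmod: "f v mod r = h (cls v)" if "v \<in> V" for v using hr[OF that] by (simp add: f_def)
  have fdiv: "f v div r = g (cls v) v" if "v \<in> V" for v using hr[OF that] by (simp add: f_def)
  have h_eq: "h (cls u) = h (cls v) \<longleftrightarrow> cls u = cls v" if "u \<in> V" "v \<in> V" for u v
    using h inP that by (auto simp: bij_betw_def inj_on_def)
  have inj: "inj_on f V"
  proof (rule inj_onI)
    fix u v assume uv: "u \<in> V" "v \<in> V" "f u = f v"
    then have c: "cls u = cls v" using fmod h_eq by metis
    moreover have "g (cls u) u = g (cls v) v" using uv fdiv by metis
    ultimately show "u = v"
      using g[OF inP[OF uv(1)]] cls_self uv unfolding bij_betw_def inj_on_def by metis
  qed
  have "f ` V \<subseteq> {..<card V}"
  proof
    fix i assume "i \<in> f ` V"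
    then obtain v where v: "v \<in> V" "i = f v" by blast
    have "f v < r * Suc (g (cls v) v)" using hr[OF v(1)] by (simp add: f_def)
    also have "\<dots> \<le> r * s" using gs[OF v(1)] by (intro mult_le_mono2) simp
    finally show "i \<in> {..<card V}" using rs v by simp
  qed
  then have "f ` V = {..<card V}"
    using inj by (intro card_subset_eq) (auto simp: card_image)
  then have bij: "bij_betw f V {..<card V}" using inj by (simp add: bij_betw_def)
  have "{u, v} \<in> edges G \<longleftrightarrow> {f u, f v} \<in> edges (turan (card V) r)" if uv: "u \<in> V" "v \<in> V" for u v
  proof -
    have "{u, v} \<in> edges G \<longleftrightarrow> v \<notin> cls u" using uv by (auto simp: cls_def in_neighborhood)
    also have "\<dots> \<longleftrightarrow> cls u \<noteq> cls v" using cls_eq cls_self uv by metis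
    finally show ?thesis
      using uv bij by (auto simp: turan_edge_iff fmod h_eq bij_betw_def)
  qed
  with bij have "graph_iso G (turan (card V) r)" unfolding graph_iso_def by auto
  then show thesis using that[of r] rs by (simp add: s_def)
qed

text \<open>The vertexwise gap in \<open>triangle_weight_ge\<close>. If \<open>z\<close> is adjacent
  to k of the three vertices, it is (k - 1)(k - 2)/2: 1 for k = 0 and k = 3, otherwise 0.\<close>

definition triangle_excess :: "'a \<Rightarrow> 'a \<Rightarrow> 'a \<Rightarrow> 'a \<Rightarrow> real" where
  "triangle_excess u v w z = adj u z * adj v z + adj v z * adj w z + adj u z * adj w z
     + 1 - adj u z - adj v z - adj w z"

lemma triangle_excess_nonneg: "triangle_excess u v w z \<ge> 0"
  using adj_cases[of u z] adj_cases[of v z] adj_cases[of w z] by (auto simp: triangle_excess_def)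

lemma triangle_excess_eq_0_iff:
  "triangle_excess u v w z = 0 \<longleftrightarrow>
    \<not> ({u, z} \<in> edges G \<and> {v, z} \<in> edges G \<and> {w, z} \<in> edges G) \<and>
    ({u, z} \<in> edges G \<or> {v, z} \<in> edges G \<or> {w, z} \<in> edges G)"
  by (auto simp: triangle_excess_def adj_def)

text \<open>Unit weights in place of an eigenvector: the count behind
  \<open>triangle_weight_ge\<close> becomes an identity once its gap is kept.\<close>

lemma sum_edge_triangles:
  "real (edge_triangles G u v) + real (edge_triangles G v w) + real (edge_triangles G u w)
    = real (vertex_degree G u) + real (vertex_degree G v) + real (vertex_degree G w)
      - real (card V) + (\<Sum>z\<in>V. triangle_excess u v w z)"
  by (simp add: edge_triangles_adj degree_adj triangle_excess_def sum.distrib sum_subtractf)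

section \<open>Small cliques as configurations of edges\<close>

lemma clique_insert:
  "clique G (insert u S) \<longleftrightarrow> u \<in> V \<and> clique G S \<and> (\<forall>v\<in>S. u \<noteq> v \<longrightarrow> {u, v} \<in> edges G)"
  by (auto simp: clique_def insert_commute)

text \<open>The three edges imply that \<open>u\<close>, \<open>v\<close> and \<open>w\<close> are
  distinct, as there are no loops.\<close>

lemma contains_complete_3_iff:
  "contains_complete G 3 \<longleftrightarrow>
    (\<exists>u v w. {u, v} \<in> edges G \<and> {v, w} \<in> edges G \<and> {u, w} \<in> edges G)"
proof
  assume "contains_complete G 3"
  then obtain S where "clique G S" "card S = 3" by (auto simp: contains_complete_def)
  moreover from this obtain u v w where "S = {u, v, w}" "u \<noteq> v" "v \<noteq> w" "u \<noteq> w"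
    by (auto simp: card_3_iff)
  ultimately have "{u, v} \<in> edges G \<and> {v, w} \<in> edges G \<and> {u, w} \<in> edges G"
    by (simp add: clique_def)
  then show "\<exists>u v w. {u, v} \<in> edges G \<and> {v, w} \<in> edges G \<and> {u, w} \<in> edges G" by blast
next
  assume "\<exists>u v w. {u, v} \<in> edges G \<and> {v, w} \<in> edges G \<and> {u, w} \<in> edges G"
  then obtain u v w where e: "{u, v} \<in> edges G" "{v, w} \<in> edges G" "{u, w} \<in> edges G" by blast
  then have "clique G {u, v, w}" "card {u, v, w} = 3"
    using edge_verts[OF e(1)] edge_verts[OF e(2)] edge_verts[OF e(3)]
    by (auto simp: clique_insert) (auto simp: clique_def)
  then show "contains_complete G 3" unfolding contains_complete_def by blast
qed

lemma contains_complete_4_iff: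
  "contains_complete G 4 \<longleftrightarrow>
    (\<exists>u v w z. {u, v} \<in> edges G \<and> {v, w} \<in> edges G \<and> {u, w} \<in> edges G \<and>
      {u, z} \<in> edges G \<and> {v, z} \<in> edges G \<and> {w, z} \<in> edges G)"
    (is "_ \<longleftrightarrow> ?R")
proof
  assume "contains_complete G 4"
  then obtain S where S: "clique G S" "card S = Suc 3" by (auto simp: contains_complete_def)
  then obtain z T where T: "S = insert z T" "z \<notin> T" "card T = 3"
    unfolding card_Suc_eq by blast
  then obtain u v w where uvw: "T = {u, v, w}" "u \<noteq> v" "v \<noteq> w" "u \<noteq> w" by (auto simp: card_3_iff)
  have "{u, v} \<in> edges G \<and> {v, w} \<in> edges G \<and> {u, w} \<in> edges G \<and>
      {u, z} \<in> edges G \<and> {v, z} \<in> edges G \<and> {w, z} \<in> edges G"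
    using S(1) T(2) uvw(2-) unfolding T(1) uvw(1) clique_def by auto
  then show ?R by blast
next
  assume ?R
  then obtain u v w z where e: "{u, v} \<in> edges G" "{v, w} \<in> edges G" "{u, w} \<in> edges G"
    "{u, z} \<in> edges G" "{v, z} \<in> edges G" "{w, z} \<in> edges G" by blast
  then have "clique G {u, v, w, z}" "card {u, v, w, z} = 4"
    using edge_verts[OF e(1)] edge_verts[OF e(2)] edge_verts[OF e(3)]
      edge_verts[OF e(4)] edge_verts[OF e(5)] edge_verts[OF e(6)]
    by (auto simp: clique_insert) (auto simp: clique_def)
  then show "contains_complete G 4" unfolding contains_complete_def by blast
qed

lemma simple_graph_delete_verts: "simple_graph (delete_verts G S)"
  using simple by (auto simp: simple_graph_def delete_verts_def)

lemma contains_triangle_delete_iff: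
  "contains_complete (delete_verts G (closed_neighborhood G z)) 3 \<longleftrightarrow>
    (\<exists>u v w. {u, v} \<in> edges G \<and> {v, w} \<in> edges G \<and> {u, w} \<in> edges G \<and>
      u \<noteq> z \<and> v \<noteq> z \<and> w \<noteq> z \<and> {u, z} \<notin> edges G \<and> {v, z} \<notin> edges G \<and> {w, z} \<notin> edges G)"
proof -
  interpret D: finite_simple_graph "delete_verts G (closed_neighborhood G z)"
    by unfold_locales (rule simple_graph_delete_verts)
  have "{u, v} \<in> edges (delete_verts G (closed_neighborhood G z)) \<longleftrightarrow>
    {u, v} \<in> edges G \<and> u \<noteq> z \<and> v \<noteq> z \<and> {u, z} \<notin> edges G \<and> {v, z} \<notin> edges G" for u v
    by (auto simp: delete_verts_def closed_neighborhood_def in_neighborhood insert_commute)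
  then show ?thesis unfolding D.contains_complete_3_iff by blast
qed

end

subsection \<open>The cases of equality\<close>

text \<open>Serves to derive \<open>n \<ge> 2\<close> from the assumption that \<open>G\<close> is
  not the bipartite Turan graph.\<close>

lemma graph_iso_turan_if_card_le_1:
  assumes "simple_graph G" "card (verts G) \<le> 1"
  shows "graph_iso G (turan (card (verts G)) r)"
proof -
  interpret finite_simple_graph G by unfold_locales (fact assms(1))
  obtain f where f: "bij_betw f V {..<card V}"
    using ex_bij_betw_finite_nat[OF finV] by (auto simp: atLeast0LessThan)
  have "{u, v} \<in> edges G \<longleftrightarrow> {f u, f v} \<in> edges (turan (card V) r)" if "u \<in> V" "v \<in> V" for u v
  proof -
    have "u = v" using that assms(2) by (metis One_nat_def card_le_Suc0_iff_eq finV)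
    then show ?thesis using edge_verts[of v v] turan_edge_iff[of "f v" "f v" "card V" r] by auto
  qed
  then show ?thesis unfolding graph_iso_def verts_turan using f by blast
qed

context finite_simple_graph
begin

text \<open>At a vertex with positive entry the neighbourhood sum is positive, so the vertex has a
  neighbour.\<close>

lemma edge_exists_if_graph_radius_pos:
  assumes "V \<noteq> {}" "graph_radius G > 0"
  obtains u v where "{u, v} \<in> edges G"
proof -
  obtain x where "nonneg_eigenpair G x (graph_radius G)"
    using Perron_eigenpair[OF assms(1)] by blast
  then interpret nonneg_eigenpair G x "graph_radius G" .
  obtain u where u: "u \<in> V" "x u > 0" using x_pos by blast
  have "(\<Sum>v\<in>V. adj u v * x v) \<noteq> 0" using eigen[OF u(1)] u assms(2) by simp
  then obtain v where "adj u v * x v \<noteq> 0"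
    by (rule sum.not_neutral_contains_not_neutral)
  then show thesis using that by (auto simp: adj_def)
qed

lemma iso_turan_if_booksize_eq:
  assumes ne: "V \<noteq> {}" and pos: "graph_radius G > 0"
    and bk: "real (booksize G) = 2 * graph_radius G - real (card V)"
  obtains r where "r > 1" "r dvd card V" "graph_iso G (turan (card V) r)"
proof -
  obtain x where "nonneg_eigenpair G x (graph_radius G)"
    using Perron_eigenpair[OF ne] by blast
  then interpret nonneg_eigenpair G x "graph_radius G" .
  have const: "x u = x v" if "u \<in> V" "v \<in> V" for u v
  proof (rule eigenvector_constant[OF pos _ that])
    show "real (edge_triangles G a b) \<le> 2 * graph_radius G - real (card V)" if "{a, b} \<in> edges G" for a b
      using edge_triangles_le_booksize[OF that] bk by linarith
  qed
  obtain c where c: "c \<in> V" "x c > 0" using x_pos by blast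
  have deg: "real (vertex_degree G u) = graph_radius G" if "u \<in> V" for u
  proof -
    have "(\<Sum>v\<in>V. adj u v) * x c = (\<Sum>v\<in>V. adj u v * x v)"
      unfolding sum_distrib_right by (intro sum.cong refl arg_cong2[of _ _ _ _ "(*)"] const c(1))
    also have "\<dots> = graph_radius G * x c" using eigen[OF that] const[OF that c(1)] by simp
    finally show ?thesis using c by (simp add: degree_adj)
  qed
  define d where "d = vertex_degree G c"
  have d: "graph_radius G = real d" using deg[OF c(1)] by (simp add: d_def)
  have reg: "regular G d" using deg d by (simp add: regular_def)
  \<comment> \<open>The union has 2d - t elements, where the codegree t is at most the booksize 2d -
    n.\<close>
  have cover: "neighborhood G u \<union> neighborhood G v = V" if e: "{u, v} \<in> edges G" for u v
  proof (rule card_seteq)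
    have "vertex_degree G u = d" "vertex_degree G v = d"
      using edge_verts[OF e] reg by (auto simp: regular_def)
    moreover have "real (edge_triangles G u v) \<le> 2 * real d - real (card V)"
      using edge_triangles_le_booksize[OF e] bk d by linarith
    ultimately show "card V \<le> card (neighborhood G u \<union> neighborhood G v)"
      using card_neighborhood_Un[of u v] by linarith
  qed (use neighborhood_subset in auto)
  obtain r where r: "r * (card V - d) = card V" "graph_iso G (turan (card V) r)"
    using iso_turan_if_neighborhoods_cover[OF ne reg cover] by blast
  have "card V > 0" "d > 0" using ne pos d by (auto simp: card_gt_0_iff)
  \<comment> \<open>\<open>r = 0\<close> would make \<open>V\<close> empty, and \<open>r = 1\<close>
    would give degree 0.\<close>
  then have "r \<noteq> 0" "r \<noteq> 1" using r(1) by (auto intro: ccontr)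
  then show thesis using that[of r] r by (metis dvd_triv_left nat_neq_iff less_one)
qed

section \<open>Regularity and tight triangles in case (b)\<close>

lemma triangle_on_edge:
  assumes "edge_triangles G u v > 0"
  obtains w where "{v, w} \<in> edges G" "{u, w} \<in> edges G"
proof -
  have "neighborhood G u \<inter> neighborhood G v \<noteq> {}"
    using assms by (auto simp: edge_triangles_def)
  then show thesis using that by (auto simp: in_neighborhood)
qed

lemma edge_triangles_pos:
  assumes "{v, w} \<in> edges G" "{u, w} \<in> edges G"
  shows "edge_triangles G u v > 0"
proof -
  have "w \<in> neighborhood G u \<inter> neighborhood G v" using assms by (simp add: in_neighborhood)
  then show ?thesis unfolding edge_triangles_def card_gt_0_iff using neighborhood_finite by blast
qed

text \<open>Positive excess means that \<open>z\<close> is adjacent to all three vertices, which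
  gives a \<open>K\<^sub>4\<close>, or to none, which gives a triangle outside the closed
  neighbourhood of \<open>z\<close>.\<close>

lemma triangle_excess_zero_iff_forbidden:
  "(\<forall>u v w z. {u, v} \<in> edges G \<longrightarrow> {v, w} \<in> edges G \<longrightarrow> {u, w} \<in> edges G \<longrightarrow> z \<in> V \<longrightarrow>
      triangle_excess u v w z = 0) \<longleftrightarrow>
   \<not> contains_complete G 4 \<and>
   (\<forall>z\<in>V. \<not> contains_complete (delete_verts G (closed_neighborhood G z)) 3)"
    (is "?L \<longleftrightarrow> ?R")
proof
  assume L: ?L
  show ?R
    unfolding contains_complete_4_iff contains_triangle_delete_iff
  proof (intro conjI ballI notI; elim exE conjE)
    fix u v w z
    assume e: "{u, v} \<in> edges G" "{v, w} \<in> edges G" "{u, w} \<in> edges G"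
      and z: "{u, z} \<in> edges G" "{v, z} \<in> edges G" "{w, z} \<in> edges G"
    have "triangle_excess u v w z = 0" using L e edge_verts[OF z(1)] by blast
    then show False using z by (simp add: triangle_excess_eq_0_iff)
  next
    fix u v w z
    assume e: "{u, v} \<in> edges G" "{v, w} \<in> edges G" "{u, w} \<in> edges G" and "z \<in> V"
      and z: "{u, z} \<notin> edges G" "{v, z} \<notin> edges G" "{w, z} \<notin> edges G"
    have "triangle_excess u v w z = 0" using L e \<open>z \<in> V\<close> by blast
    then show False using z by (simp add: triangle_excess_eq_0_iff)
  qed
next
  assume R: ?R
  show ?L
  proof (intro allI impI)
    fix u v w z
    assume e: "{u, v} \<in> edges G" "{v, w} \<in> edges G" "{u, w} \<in> edges G" and z: "z \<in> V"
    have "\<not> ({u, z} \<in> edges G \<and> {v, z} \<in> edges G \<and> {w, z} \<in> edges G)"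
      using R e unfolding contains_complete_4_iff by blast
    moreover have "{u, z} \<in> edges G \<or> {v, z} \<in> edges G \<or> {w, z} \<in> edges G"
    proof (rule ccontr)
      assume nonadj: "\<not> ?thesis"
      \<comment> \<open>A triangle vertex equal to \<open>z\<close> would make \<open>z\<close>
        adjacent to the other two.\<close>
      then have "u \<noteq> z" "v \<noteq> z" "w \<noteq> z" using e by (auto simp: insert_commute)
      then have "contains_complete (delete_verts G (closed_neighborhood G z)) 3"
        unfolding contains_triangle_delete_iff using e nonadj by blast
      then show False using R z by blast
    qed
    ultimately show "triangle_excess u v w z = 0" by (simp add: triangle_excess_eq_0_iff)
  qed
qed

lemma regular_triangle_equality:
  assumes reg: "regular G d"
    and e: "{u, v} \<in> edges G" "{v, w} \<in> edges G" "{u, w} \<in> edges G"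
  shows "real (edge_triangles G u v) + real (edge_triangles G v w) + real (edge_triangles G u w)
    = 3 * real d - real (card V) + (\<Sum>z\<in>V. triangle_excess u v w z)"
proof -
  have "vertex_degree G u = d" "vertex_degree G v = d" "vertex_degree G w = d"
    using reg edge_verts[OF e(1)] edge_verts[OF e(2)] by (simp_all add: regular_def)
  then show ?thesis unfolding sum_edge_triangles by simp
qed

text \<open>The three codegrees sum to three times the booksize plus the total excess, but none
  exceeds the booksize; so all are maximal and the excess is 0.\<close>

lemma regular_triangle_tight:
  assumes reg: "regular G d" and bk: "real (booksize G) = real d - real (card V) / 3"
    and e: "{u, v} \<in> edges G" "{v, w} \<in> edges G" "{u, w} \<in> edges G"
  shows "edge_triangles G u v = booksize G" and "z \<in> V \<Longrightarrow> triangle_excess u v w z = 0"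
proof -
  have le: "edge_triangles G u v \<le> booksize G" "edge_triangles G v w \<le> booksize G"
    "edge_triangles G u w \<le> booksize G"
    using e by (simp_all add: edge_triangles_le_booksize)
  have ex: "(\<Sum>z\<in>V. triangle_excess u v w z) \<ge> 0"
    by (intro sum_nonneg triangle_excess_nonneg)
  show "edge_triangles G u v = booksize G"
    using regular_triangle_equality[OF reg e] le ex bk by linarith
  have "(\<Sum>z\<in>V. triangle_excess u v w z) = 0"
    using regular_triangle_equality[OF reg e] le ex bk by linarith
  then show "triangle_excess u v w z = 0" if "z \<in> V"
    using that by (subst (asm) sum_nonneg_eq_0_iff) (auto intro: triangle_excess_nonneg)
qed

lemma regular_if_booksize_eq:
  assumes ne: "V \<noteq> {}" and ge: "2 * graph_radius G \<ge> real (card V)"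
    and bk: "real (booksize G) = graph_radius G - real (card V) / 3"
  obtains d where "regular G d" "real d = graph_radius G"
proof -
  obtain x where "nonneg_eigenpair G x (graph_radius G)"
    using Perron_eigenpair[OF ne] by blast
  then interpret nonneg_eigenpair G x "graph_radius G" .
  have n: "real (card V) > 0" using ne by (simp add: card_gt_0_iff)
  \<comment> \<open>The condition \<lambda> \<le> 3 bk = 3 \<lambda> - n is the assumption
    \<open>ge\<close>, which also gives bk \<ge> n/6 > 0.\<close>
  have "3 * graph_radius G * (graph_radius G - real (booksize G)) \<le> (\<Sum>u\<in>V. \<Sum>v\<in>V. adj u v)"
  proof (rule book_edge_bound)
    show "real (edge_triangles G u v) \<le> real (booksize G)" if "{u, v} \<in> edges G" for u v
      using edge_triangles_le_booksize[OF that] by simp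
  qed (use n ge bk in linarith)+
  then have "graph_radius G * real (card V) \<le> (\<Sum>u\<in>V. \<Sum>v\<in>V. adj u v)"
    unfolding bk by simp
  then show thesis using regular_if_sum_adj_ge[OF ne] that by blast
qed

text \<open>If \<open>n\<close> is odd, then \<open>graph_radius (turan n 2)\<close> is slightly smaller than \<open>n / 2\<close>. The gap is
  closed by integrality: \<open>3 * graph_radius G\<close> is an integer here.\<close>

lemma graph_radius_ge_half:
  assumes n: "card V \<ge> 2" and ge: "graph_radius G \<ge> graph_radius (turan (card V) 2)"
    and bk: "real (booksize G) = graph_radius G - real (card V) / 3"
  shows "2 * graph_radius G \<ge> real (card V)"
proof (rule ccontr)
  define k where "k = booksize G"
  define n where "n = card V"
  assume "\<not> ?thesis"
  moreover have rad: "3 * graph_radius G = real (3 * k + n)" using bk by (simp add: k_def n_def)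
  ultimately have "2 * (3 * k + n) < 3 * n" by (simp add: n_def)
  then have lt: "6 * k + 1 \<le> n" by simp
  have "2 * (real n * graph_radius G) \<ge> (real n)\<^sup>2 - 1"
  proof -
    have "real n * graph_radius (turan n 2) \<le> real n * graph_radius G"
      using ge by (intro mult_left_mono) (auto simp: n_def)
    moreover have "n > 0" using n by (simp add: n_def)
    ultimately show ?thesis using graph_radius_turan_2_ge[of n] by linarith
  qed
  then have "2 * (real n * (3 * graph_radius G)) \<ge> 3 * (real n)\<^sup>2 - 3" by simp
  then have "real (2 * (n * (3 * k + n)) + 3) \<ge> real (3 * n\<^sup>2)" unfolding rad by simp
  then have "3 * n\<^sup>2 \<le> 2 * (n * (3 * k + n)) + 3" by (simp only: of_nat_le_iff)
  then have "n * n \<le> n * (6 * k) + 3" by (simp add: power2_eq_square algebra_simps)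
  \<comment> \<open>The two estimates for \<open>n * n\<close> leave \<open>n \<le> 3\<close>; then
    \<open>k = 0\<close> by \<open>lt\<close>, and \<open>n * n \<le> 3\<close> contradicts
    \<open>n \<ge> 2\<close>.\<close>
  moreover have "n * (6 * k + 1) \<le> n * n" using lt by (intro mult_le_mono2)
  ultimately have "n \<le> 3" by (simp add: algebra_simps)
  then have "k = 0" using lt by simp
  with \<open>n * n \<le> n * (6 * k) + 3\<close> n have "n * n \<le> 3" "n \<ge> 2" by (simp_all add: n_def)
  then show False using mult_le_mono[of 2 n 2 n] by simp
qed

end

theorem proposition3p6:
  fixes G :: "'a ugraph" and n :: nat
  assumes "simple_graph G"
    and "card (verts G) = n"
    and "\<not> graph_iso G (turan n 2)"
    and "graph_radius G \<ge> graph_radius (turan n 2)"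
  shows "(real (booksize G) = 2 * graph_radius G - real n \<longleftrightarrow>
           (\<exists>r\<ge>3. r dvd n \<and> graph_iso G (turan n r))) \<and>
         (real (booksize G) = graph_radius G - real n / 3 \<longleftrightarrow>
           (\<exists>d. regular G d \<and> real d \<ge> real n / 2 \<and>
             (real d = real n / 2 \<and> contains_complete G 3 \<and>
                (\<forall>u v. {u, v} \<in> edges G \<longrightarrow>
                   edge_triangles G u v = 0 \<or> real (edge_triangles G u v) = real n / 6)
              \<or>
              real d > real n / 2 \<and> \<not> contains_complete G 4 \<and>
                (\<forall>u v. {u, v} \<in> edges G \<longrightarrow> edge_triangles G u v = booksize G) \<and>
                (\<forall>v\<in>verts G. \<not> contains_complete
                   (delete_verts G (closed_neighborhood G v)) 3))))"
proof -
  interpret finite_simple_graph G by unfold_locales (fact assms(1))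
  have n2: "n \<ge> 2"
    using graph_iso_turan_if_card_le_1[OF assms(1), of 2] assms(2,3) by force
  have ne: "V \<noteq> {}" using n2 assms(2) by auto
  have "2 * (real n * graph_radius (turan n 2)) \<ge> (real n)\<^sup>2 - 1"
    using n2 by (intro graph_radius_turan_2_ge) simp
  moreover have "(real n)\<^sup>2 > 1" using n2 by simp
  ultimately have "real n * graph_radius (turan n 2) > 0" by linarith
  then have pos: "graph_radius G > 0" using assms(4) n2 by (simp add: zero_less_mult_iff)
  then obtain a b where ab: "{a, b} \<in> edges G"
    using edge_exists_if_graph_radius_pos[OF ne] by blast
  obtain p q where pq: "{p, q} \<in> edges G" "edge_triangles G p q = booksize G"
    using booksize_attained[OF ab] .

  have turan: "\<exists>r\<ge>3. r dvd n \<and> graph_iso G (turan n r)"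
    if bk: "real (booksize G) = 2 * graph_radius G - real n"
  proof -
    obtain r where "r > 1" "r dvd n" "graph_iso G (turan n r)"
      using iso_turan_if_booksize_eq[OF ne pos] bk assms(2) by auto
    moreover from this have "r \<noteq> 2" using assms(3) by auto
    ultimately show ?thesis by (intro exI[of _ r]) auto
  qed
  have turan_conv: "real (booksize G) = 2 * graph_radius G - real n"
    if r: "r \<ge> 3" "r dvd n" "graph_iso G (turan n r)" for r
  proof -
    have r0: "r > 0" using r by simp
    \<comment> \<open>Ensures that the natural-number differences \<open>n - n div r\<close> and
      \<open>n - 2 * (n div r)\<close> are not truncated.\<close>
    have "3 * (n div r) \<le> r * (n div r)" using r by (intro mult_le_mono1)
    then have "3 * (n div r) \<le> n" using r by simp
    moreover have "graph_radius G = real (n - n div r)"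
      using graph_radius_regular[OF ne iso_turan_parameters(1)[OF r(3) r0 r(2)]] .
    moreover have "booksize G = n - 2 * (n div r)"
      using iso_turan_parameters(2)[OF r(3) r0 r(2) pq(1)] pq(2) by simp
    ultimately show ?thesis by (simp add: of_nat_diff)
  qed
  have regular: "\<exists>d. regular G d \<and> real d \<ge> real n / 2 \<and>
             (real d = real n / 2 \<and> contains_complete G 3 \<and>
                (\<forall>u v. {u, v} \<in> edges G \<longrightarrow>
                   edge_triangles G u v = 0 \<or> real (edge_triangles G u v) = real n / 6)
              \<or>
              real d > real n / 2 \<and> \<not> contains_complete G 4 \<and>
                (\<forall>u v. {u, v} \<in> edges G \<longrightarrow> edge_triangles G u v = booksize G) \<and>
                (\<forall>v\<in>verts G. \<not> contains_complete
                   (delete_verts G (closed_neighborhood G v)) 3))"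
    if bk: "real (booksize G) = graph_radius G - real n / 3"
  proof -
    have half: "2 * graph_radius G \<ge> real n"
      using graph_radius_ge_half n2 assms(2,4) bk by simp
    then obtain d where d: "regular G d" "real d = graph_radius G"
      using regular_if_booksize_eq[OF ne] bk assms(2) by auto
    have bkd: "real (booksize G) = real d - real (card V) / 3" using bk d assms(2) by simp
    have tight: "edge_triangles G u v = booksize G"
      if "{u, v} \<in> edges G" "edge_triangles G u v > 0" for u v
      using triangle_on_edge[OF that(2)] regular_triangle_tight(1)[OF d(1) bkd that(1)] by metis
    \<comment> \<open>The booksize is at least n/6, so an edge attaining it lies in a
      triangle.\<close>
    have "edge_triangles G p q > 0" using pq(2) bk half n2 by linarith
    then have K3: "contains_complete G 3"
      using triangle_on_edge[of p q] pq(1) unfolding contains_complete_3_iff by metis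
    show ?thesis
    proof (cases "real d = real n / 2")
      case True
      then have "real (booksize G) = real n / 6" using bk d by simp
      then have "edge_triangles G u v = 0 \<or> real (edge_triangles G u v) = real n / 6"
        if "{u, v} \<in> edges G" for u v
        using tight[OF that] by (cases "edge_triangles G u v = 0") simp_all
      then show ?thesis using True d(1) K3 by (intro exI[of _ d]) simp
    next
      case False
      then have gt: "real d > real n / 2" using half d by simp
      have "edge_triangles G u v > 0" if "{u, v} \<in> edges G" for u v
        using edge_triangles_ge[of u v] edge_verts[OF that] d(1) gt assms(2) by (auto simp: regular_def)
      then have "\<forall>u v. {u, v} \<in> edges G \<longrightarrow> edge_triangles G u v = booksize G"
        using tight by blast
      moreover have "\<not> contains_complete G 4 \<and>
          (\<forall>z\<in>V. \<not> contains_complete (delete_verts G (closed_neighborhood G z)) 3)"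
        using regular_triangle_tight(2)[OF d(1) bkd]
        unfolding triangle_excess_zero_iff_forbidden[symmetric] by blast
      ultimately show ?thesis using gt d(1) by (intro exI[of _ d]) auto
    qed
  qed
  have half_conv: "real (booksize G) = graph_radius G - real n / 3"
    if reg: "regular G d" and d: "real d = real n / 2" and K3: "contains_complete G 3"
      and et: "\<And>u v. {u, v} \<in> edges G \<Longrightarrow> edge_triangles G u v = 0 \<or> real (edge_triangles G u v) = real n / 6"
    for d
  proof -
    obtain u v w where e: "{u, v} \<in> edges G" "{v, w} \<in> edges G" "{u, w} \<in> edges G"
      using K3 unfolding contains_complete_3_iff by blast
    \<comment> \<open>An edge of a triangle has positive codegree, which excludes the value 0; so
      n/6 is attained.\<close>
    have "real (edge_triangles G u v) = real n / 6" using et[OF e(1)] edge_triangles_pos[OF e(2,3)] by auto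
    then have "real (booksize G) \<ge> real n / 6" using edge_triangles_le_booksize[OF e(1)] by linarith
    moreover have "real (booksize G) \<le> real n / 6" using et[OF pq(1)] pq(2) by auto
    ultimately show ?thesis using graph_radius_regular[OF ne reg] d by simp
  qed
  have above_half_conv: "real (booksize G) = graph_radius G - real n / 3"
    if reg: "regular G d" and d: "real d > real n / 2" and K4: "\<not> contains_complete G 4"
      and et: "\<And>u v. {u, v} \<in> edges G \<Longrightarrow> edge_triangles G u v = booksize G"
      and del: "\<forall>v\<in>V. \<not> contains_complete (delete_verts G (closed_neighborhood G v)) 3"
    for d
  proof -
    have "edge_triangles G a b > 0"
      using edge_triangles_ge[of a b] edge_verts[OF ab] reg d assms(2) by (auto simp: regular_def)
    then obtain c where c: "{b, c} \<in> edges G" "{a, c} \<in> edges G" using triangle_on_edge by blast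
    \<comment> \<open>One triangle suffices: its codegrees all equal the booksize, so the identity
      for regular graphs determines it.\<close>
    have "(\<Sum>z\<in>V. triangle_excess a b c z) = 0"
      using K4 del triangle_excess_zero_iff_forbidden ab c by (intro sum.neutral) blast
    then have "3 * real (booksize G) = 3 * real d - real n"
      using regular_triangle_equality[OF reg ab c] et ab c assms(2) by simp
    then show ?thesis using graph_radius_regular[OF ne reg] by simp
  qed
  show ?thesis
  proof (intro conjI iffI turan regular)
    assume "\<exists>r\<ge>3. r dvd n \<and> graph_iso G (turan n r)"
    then show "real (booksize G) = 2 * graph_radius G - real n" using turan_conv by blast
  next
    assume "\<exists>d. regular G d \<and> real d \<ge> real n / 2 \<and>
             (real d = real n / 2 \<and> contains_complete G 3 \<and>
                (\<forall>u v. {u, v} \<in> edges G \<longrightarrow>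
                   edge_triangles G u v = 0 \<or> real (edge_triangles G u v) = real n / 6)
              \<or>
              real d > real n / 2 \<and> \<not> contains_complete G 4 \<and>
                (\<forall>u v. {u, v} \<in> edges G \<longrightarrow> edge_triangles G u v = booksize G) \<and>
                (\<forall>v\<in>verts G. \<not> contains_complete
                   (delete_verts G (closed_neighborhood G v)) 3))" (is "\<exists>d. ?R d")
    then obtain d where "?R d" ..
    then show "real (booksize G) = graph_radius G - real n / 3"
    proof (elim conjE disjE, goal_cases)
      case 1
      then show ?case by (intro half_conv) simp_all
    next
      case 2
      then show ?case by (intro above_half_conv) simp_all
    qed
  qed
qed

end
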